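(* (i) For each $\mathcal{F}$-sequence $f$ there is, up to equivalence, a unique connected simply connected Cartan scheme $\mathcal{C}$ (of rank two, with $I=\{1,2\}$ and object set $A$) such that $\mathcal{R}^{\mathrm{re}}(\mathcal{C})$ is a finite root system and the set of entries of $f$ is $R^a_+$ for some $a\in A$. (ii) Conversely, let $\mathcal{C}=(I,A,(\rho_i)_{i\in I},(C^a)_{a\in A})$ be a Cartan scheme of rank two ($I=\{1,2\}$) such that $\mathcal{R}^{\mathrm{re}}(\mathcal{C})$ is a finite irreducible root system, and let $a\in A$. Then sorting the elements of $R^a\cap\mathbb{N}_0^2$ with respect to $\le_{\mathbb{Q}}$ in ascending order yields an $\mathcal{F}$-sequence.
   Context: $\mathcal{F}$-sequences are the finite sequences of length $\ge 3$ with entries in $\mathbb{N}_0^2$ given by the recursion: (1) $((0,1),(1,1),(1,0))$ is an $\mathcal{F}$-sequence; (2) if $(v_1,\dots,v_n)$ is an $\mathcal{F}$-sequence, then $(v_1,\dots,v_i,v_i+v_{i+1},v_{i+1},\dots,v_n)$ is an $\mathcal{F}$-sequence for each $i=1,\dots,n-1$; (3) every $\mathcal{F}$-sequence is obtained recursively by (1) and (2). For $(a,b),(c,d)\in\mathbb{N}_0^2\setminus\{0\}$ write $(a,b)\le_{\mathbb{Q}}(c,d)$ if and only if $ad\le cb$. Cartan schemes (rank two). Let $I=\{1,2\}$, $A$ a non-empty set, $\rho_i:A\to A$ a map for each $i\in I$, and $C^a=(c^a_{jk})_{j,k\in I}$ an integer matrix for each $a\in A$. The quadruple $\mathcal{C}=(I,A,(\rho_i)_{i\in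 I},(C^a)_{a\in A})$ is a Cartan scheme of rank two if every $C^a$ is a generalized Cartan matrix ($c^a_{ii}=2$; $c^a_{ij}\le 0$ for $i\ne j$; $c^a_{ij}=0$ implies $c^a_{ji}=0$), $\rho_i^2=\mathrm{id}$ for all $i$, and $c^a_{ij}=c^{\rho_i(a)}_{ij}$ for all $a\in A$, $i,j\in I$. Let $\alpha_1=(1,0)$, $\alpha_2=(0,1)$ be the standard basis of $\mathbb{Z}^I=\mathbb{Z}^2$ and let $\sigma_i^a\in\mathrm{Aut}(\mathbb{Z}^I)$, $\sigma_i^a(\alpha_j)=\alpha_j-c^a_{ij}\alpha_i$. The Weyl groupoid $\mathcal{W}(\mathcal{C})$ is the category with object set $A$ whose morphisms are generated by the maps $\sigma_i^a$, regarded as elements of $\mathrm{Hom}(a,\rho_i(a))$ (so $\mathrm{Hom}(a,b)$ is the set of linear maps obtained as compositions of such maps along a path from $a$ to $b$). $\mathcal{C}$ is connected if $\mathcal{W}(\mathcal{C})$ is connected, simply connected if $\mathrm{End}(a)$ is trivial for all $a\in A$, and irreducible if every $C^a$ is indecomposable. The real roots at $a$ are $R^a=\{\varphi(\alpha_i)\mid i\in I,\ \varphi\in\mathrm{Hom}(b,a),\ b\in A\}$, $R^a_+=R^a\cap\mathbb{N}_0^I$, and $\mathcal{R}^{\mathrm{re}}(\mathcal{C})=(\mathcal{C},(R^a)_{a\in A})$. A family $(R^a)_{a\in A}$ of subsets of $\mathbb{Z}^I$ is a root system of type $\mathcal{C}$ if, with $R^a_+=R^a\cap\mathbb{N}_0^I$: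 (R1) $R^a=R^a_+\cup -R^a_+$; (R2) $R^a\cap\mathbb{Z}\alpha_i=\{\alpha_i,-\alpha_i\}$; (R3) $\sigma_i^a(R^a)=R^{\rho_i(a)}$; (R4) if $i\ne j$ and $m=|R^a\cap(\mathbb{N}_0\alpha_i+\mathbb{N}_0\alpha_j)|$ is finite then $(\rho_i\rho_j)^m(a)=a$. It is finite if all $R^a$ are finite, and irreducible if $\mathcal{C}$ is irreducible. Two Cartan schemes are equivalent if there are bijections $\varphi_0:I\to I'$ and $\varphi_1:A\to A'$ with $\varphi_1(\rho_i(a))=\rho'_{\varphi_0(i)}(\varphi_1(a))$ and $c^{a}_{ij}=c'^{\varphi_1(a)}_{\varphi_0(i)\varphi_0(j)}$ for all $i,j\in I$, $a\in A$. *)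

theory Defs
  imports "HOL-Analysis.Cartesian_Space"
begin

text \<open>
  The index set \<open>I = {1, 2}\<close> is the two-element type \<open>2\<close> (in which \<open>0 = 2\<close>), and \<open>\<int>\<^sup>I\<close> is
  the type \<open>int ^ 2\<close>.
\<close>

definition nonneg_vecs :: "(int ^ 2) set" where
  "nonneg_vecs = {v. \<forall>i. 0 \<le> v $ i}"

inductive F_seq :: "(int ^ 2) list \<Rightarrow> bool" where
  base: "F_seq [vector [0, 1], vector [1, 1], vector [1, 0]]"
| insert: "F_seq (us @ v # w # ws) \<Longrightarrow> F_seq (us @ v # (v + w) # w # ws)"

text \<open>Only meant for non-zero vectors with non-negative entries.\<close>

definition le_Q :: "int ^ 2 \<Rightarrow> int ^ 2 \<Rightarrow> bool" where
  "le_Q v w \<longleftrightarrow> v $ 1 * w $ 2 \<le> w $ 1 * v $ 2"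

definition sorts_to :: "(int ^ 2) set \<Rightarrow> (int ^ 2) list \<Rightarrow> bool" where
  "sorts_to S vs \<longleftrightarrow> set vs = S \<and> distinct vs \<and> sorted_wrt le_Q vs"

record 'a cartan_data =
  objs :: "'a set"
  rho :: "2 \<Rightarrow> 'a \<Rightarrow> 'a"
  cmat :: "'a \<Rightarrow> int ^ 2 ^ 2"

definition gen_cartan_matrix :: "int ^ 2 ^ 2 \<Rightarrow> bool" where
  "gen_cartan_matrix M \<longleftrightarrow>
     (\<forall>i. M $ i $ i = 2) \<and>
     (\<forall>i j. i \<noteq> j \<longrightarrow> M $ i $ j \<le> 0) \<and>
     (\<forall>i j. M $ i $ j = 0 \<longrightarrow> M $ j $ i = 0)"

definition indecomposable :: "int ^ 2 ^ 2 \<Rightarrow> bool" where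
  "indecomposable M \<longleftrightarrow>
     \<not> (\<exists>J. J \<noteq> {} \<and> J \<noteq> UNIV \<and> (\<forall>i\<in>J. \<forall>j\<in>- J. M $ i $ j = 0 \<and> M $ j $ i = 0))"

definition cartan_scheme :: "'a cartan_data \<Rightarrow> bool" where
  "cartan_scheme C \<longleftrightarrow>
     objs C \<noteq> {} \<and>
     (\<forall>i. \<forall>a\<in>objs C. rho C i a \<in> objs C) \<and>
     (\<forall>a\<in>objs C. gen_cartan_matrix (cmat C a)) \<and>
     (\<forall>i. \<forall>a\<in>objs C. rho C i (rho C i a) = a) \<and>
     (\<forall>a\<in>objs C. \<forall>i j. cmat C a $ i $ j = cmat C (rho C i a) $ i $ j)"

definition irreducible_scheme :: "'a cartan_data \<Rightarrow> bool" where
  "irreducible_scheme C \<longleftrightarrow> (\<forall>a\<in>objs C. indecomposable (cmat C a))"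

definition simple_root :: "2 \<Rightarrow> int ^ 2" where
  "simple_root i = axis i 1"

definition refl_map :: "'a cartan_data \<Rightarrow> 2 \<Rightarrow> 'a \<Rightarrow> int ^ 2 \<Rightarrow> int ^ 2" where
  "refl_map C i a v =
     (\<Sum>j\<in>UNIV. v $ j *s (simple_root j - cmat C a $ i $ j *s simple_root i))"

text \<open>Pairs of a target object and a linear map, composed along paths of generators starting at \<open>a\<close>.\<close>

inductive_set weyl_paths :: "'a cartan_data \<Rightarrow> 'a \<Rightarrow> ('a \<times> (int ^ 2 \<Rightarrow> int ^ 2)) set"
  for C :: "'a cartan_data" and a :: 'a where
  id: "a \<in> objs C \<Longrightarrow> (a, id) \<in> weyl_paths C a"
| comp: "(b, \<phi>) \<in> weyl_paths C a \<Longrightarrow> (rho C i b, refl_map C i b \<circ> \<phi>) \<in> weyl_paths C a"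

definition Hom :: "'a cartan_data \<Rightarrow> 'a \<Rightarrow> 'a \<Rightarrow> (int ^ 2 \<Rightarrow> int ^ 2) set" where
  "Hom C a b = {\<phi>. (b, \<phi>) \<in> weyl_paths C a}"

definition connected_scheme :: "'a cartan_data \<Rightarrow> bool" where
  "connected_scheme C \<longleftrightarrow> (\<forall>a\<in>objs C. \<forall>b\<in>objs C. Hom C a b \<noteq> {})"

definition simply_connected_scheme :: "'a cartan_data \<Rightarrow> bool" where
  "simply_connected_scheme C \<longleftrightarrow> (\<forall>a\<in>objs C. Hom C a a = {id})"

definition real_roots :: "'a cartan_data \<Rightarrow> 'a \<Rightarrow> (int ^ 2) set" where
  "real_roots C a = {\<phi> (simple_root i) | \<phi> i b. b \<in> objs C \<and> \<phi> \<in> Hom C b a}"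

text \<open>The conjuncts are (R1)--(R4); the values of the family outside \<open>objs C\<close> are irrelevant.\<close>

definition root_system :: "'a cartan_data \<Rightarrow> ('a \<Rightarrow> (int ^ 2) set) \<Rightarrow> bool" where
  "root_system C R \<longleftrightarrow>
     (\<forall>a\<in>objs C. R a = (R a \<inter> nonneg_vecs) \<union> uminus ` (R a \<inter> nonneg_vecs)) \<and>
     (\<forall>a\<in>objs C. \<forall>i. R a \<inter> range (\<lambda>k. k *s simple_root i) = {simple_root i, - simple_root i}) \<and>
     (\<forall>a\<in>objs C. \<forall>i. refl_map C i a ` R a = R (rho C i a)) \<and>
     (\<forall>a\<in>objs C. \<forall>i j. i \<noteq> j \<longrightarrow>
        (let S = R a \<inter> {int p *s simple_root i + int q *s simple_root j | p q. True}
         in finite S \<longrightarrow> ((rho C i \<circ> rho C j) ^^ card S) a = a))"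

definition finite_root_system :: "'a cartan_data \<Rightarrow> ('a \<Rightarrow> (int ^ 2) set) \<Rightarrow> bool" where
  "finite_root_system C R \<longleftrightarrow> root_system C R \<and> (\<forall>a\<in>objs C. finite (R a))"

definition equivalent_schemes :: "'a cartan_data \<Rightarrow> 'b cartan_data \<Rightarrow> bool" where
  "equivalent_schemes C D \<longleftrightarrow>
     (\<exists>\<phi>\<^sub>0 \<phi>\<^sub>1. bij \<phi>\<^sub>0 \<and> bij_betw \<phi>\<^sub>1 (objs C) (objs D) \<and>
        (\<forall>a\<in>objs C. \<forall>i. \<phi>\<^sub>1 (rho C i a) = rho D (\<phi>\<^sub>0 i) (\<phi>\<^sub>1 a)) \<and>
        (\<forall>a\<in>objs C. \<forall>i j. cmat C a $ i $ j = cmat D (\<phi>\<^sub>1 a) $ \<phi>\<^sub>0 i $ \<phi>\<^sub>0 j))"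

definition realizes :: "'a cartan_data \<Rightarrow> (int ^ 2) list \<Rightarrow> bool" where
  "realizes C f \<longleftrightarrow>
     cartan_scheme C \<and> connected_scheme C \<and> simply_connected_scheme C \<and>
     finite_root_system C (real_roots C) \<and>
     (\<exists>a\<in>objs C. set f = real_roots C a \<inter> nonneg_vecs)"

lemma simple_root_vector:
  "simple_root 1 = vector [1, 0]" "simple_root 2 = vector [0, 1]"
  by (simp_all add: simple_root_def vec_eq_iff forall_2 axis_def)

lemma refl_map_simple_root:
  "refl_map C i a (simple_root j) = simple_root j - cmat C a $ i $ j *s simple_root i"
  using exhaust_2[of j] exhaust_2[of i]
  by (auto simp: refl_map_def simple_root_def vec_eq_iff forall_2 sum_2 axis_def)

lemma F_seq_nonneg: "F_seq f \<Longrightarrow> set f \<subseteq> nonneg_vecs"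
  by (induction rule: F_seq.induct) (auto simp: nonneg_vecs_def forall_2)

lemma F_seq_length: "F_seq f \<Longrightarrow> 3 \<le> length f"
  by (induction rule: F_seq.induct) auto

end

theory Submission
  imports Defs
begin

text \<open>
  Up to the conditions on the ends, \<open>\<F>\<close>-sequences are exactly the sequences in \<open>\<nat>\<^sub>0\<^sup>2\<close> in which
  consecutive entries have determinant 1. Starting at an object \<open>a\<close>, the alternating words in the
  two reflections produce real roots \<open>\<beta>\<^sub>0, \<beta>\<^sub>1, \<dots>\<close> with
  \<open>\<beta>\<^bsub>k+1\<^esub> = c\<^sub>k \<beta>\<^sub>k - \<beta>\<^bsub>k-1\<^esub>\<close>, where \<open>- c\<^sub>k\<close> is a Cartan entry, so
  consecutive ones have determinant 1. Finiteness forces some first \<open>\<beta>\<^sub>n\<close> to be negative, and then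
  \<open>\<beta>\<^sub>0, \<dots>, \<beta>\<^bsub>n-1\<^esub>\<close> are all positive roots in slope order, which is (ii). The roots at an object
  determine its Cartan matrix and hence the roots at its neighbours, while (R4) and simple
  connectedness make the object set a cycle of length \<open>2n\<close>; this gives uniqueness.
  For existence, extend the \<open>\<F>\<close>-sequence antiperiodically and read the \<open>c\<^sub>k\<close> off the recursion.
\<close>

section \<open>Unimodular sequences\<close>

text \<open>The determinant with rows \<open>w\<close>, \<open>v\<close>; this order makes its sign
  agree with \<open>le_Q\<close>, so ascending pairs have positive \<open>cross\<close>.\<close>

definition cross :: "int ^ 2 \<Rightarrow> int ^ 2 \<Rightarrow> int" where
  "cross v w = w $ 1 * v $ 2 - v $ 1 * w $ 2"

lemma le_Q_iff_cross: "le_Q v w \<longleftrightarrow> 0 \<le> cross v w"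
  by (simp add: le_Q_def cross_def)

lemma cross_simps [simp]:
  "cross v v = 0" "cross (- v) w = - cross v w" "cross v (- w) = - cross v w"
  "cross (v + v') w = cross v w + cross v' w" "cross v (w + w') = cross v w + cross v w'"
  "cross (x *s v) w = x * cross v w" "cross v (x *s w) = x * cross v w"
  by (auto simp: cross_def algebra_simps)

lemma cross_commute: "cross w v = - cross v w"
  by (simp add: cross_def)

text \<open>On the whole plane this relation is not transitive. In the quadrant the two inequalities
  force \<open>v $ 1\<close> to be positive, and the identity below writes
  \<open>v $ 1 * cross u w\<close> as a non-negative plus a positive term.\<close>

lemma cross_trans:
  assumes "u \<in> nonneg_vecs" "v \<in> nonneg_vecs" "w \<in> nonneg_vecs" "0 < cross u v" "0 < cross v w"
  shows "0 < cross u w"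
proof -
  have n: "0 \<le> u $ 1" "0 \<le> u $ 2" "0 \<le> v $ 1" "0 \<le> v $ 2" "0 \<le> w $ 1" "0 \<le> w $ 2"
    using assms(1-3) by (auto simp: nonneg_vecs_def)
  have uv: "u $ 1 * v $ 2 < v $ 1 * u $ 2" and vw: "v $ 1 * w $ 2 < w $ 1 * v $ 2"
    using assms by (auto simp: cross_def)
  have pos: "0 < v $ 2" "0 < v $ 1"
    using n uv vw by (smt (verit) mult_nonneg_nonneg mult_eq_0_iff)+
  have "0 < w $ 1" using n vw by (smt (verit) mult_nonneg_nonneg mult_eq_0_iff)
  have "v $ 1 * cross u w = u $ 1 * cross v w + w $ 1 * cross u v"
    by (simp add: cross_def algebra_simps)
  also have "\<dots> > 0"
    using n \<open>0 < w $ 1\<close> assms(4,5) by (simp add: add_nonneg_pos)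
  finally show ?thesis
    using pos by (simp add: zero_less_mult_iff)
qed

lemma unimodular_expansion:
  assumes "cross u v = 1"
  shows "w = cross w v *s u + cross u w *s v"
proof -
  have "w $ i * cross u v = cross w v * u $ i + cross u w * v $ i" for i
    using exhaust_2[of i] by (auto simp: cross_def algebra_simps)
  then show ?thesis using assms by (simp add: vec_eq_iff)
qed

text \<open>In Cramer's expansion of \<open>w\<close> the coefficient of \<open>u\<close> is
  \<open>cross w v = -1\<close>. The multiplier \<open>cross u w\<close> yields the insertion test
  in \<open>F_seqI\<close> and the coefficient \<open>quid\<close>.\<close>

lemma unimodular_neighbours:
  assumes "cross u v = 1" "cross v w = 1"
  shows "u + w = cross u w *s v"
  using unimodular_expansion[OF assms(1), of w] assms(2)
  by (simp add: cross_commute[of w v] vec_eq_iff)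

lemma F_seq_unimodular:
  assumes "F_seq f"
  shows "successively (\<lambda>v w. cross v w = 1) f \<and> hd f = vector [0, 1] \<and> last f = vector [1, 0]"
  using assms
proof induction
  case base
  then show ?case by (simp add: cross_def)
next
  case (insert us v w ws)
  then show ?case by (cases us) (auto simp: successively_append_iff successively_Cons hd_append)
qed

text \<open>At the first weak descent of the coordinate sum, the entry is the sum of its two neighbours.\<close>

lemma F_seqI:
  assumes "3 \<le> length f" "set f \<subseteq> nonneg_vecs" "successively (\<lambda>v w. cross v w = 1) f"
    "hd f = vector [0, 1]" "last f = vector [1, 0]"
  shows "F_seq f"
  using assms
proof (induction "length f" arbitrary: f rule: less_induct)
  case less
  define s where "s v = v $ 1 + v $ 2" for v :: "int ^ 2"
  let ?n = "length f"
  have nn: "0 \<le> f ! k $ 1" "0 \<le> f ! k $ 2" if "k < ?n" for k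
    using less.prems(2) nth_mem[OF that] by (auto simp: nonneg_vecs_def)
  have adj: "cross (f ! k) (f ! Suc k) = 1" if "Suc k < ?n" for k
    using less.prems(3) that by (simp add: successively_conv_nth)
  have f0: "f ! 0 = vector [0, 1]" and fl: "f ! (?n - 1) = vector [1, 0]"
    using less.prems by (metis hd_conv_nth last_conv_nth list.size(3) not_numeral_le_zero)+
  have spos: "0 < s (f ! k)" if k: "k < ?n" for k
  proof -
    have "f ! k \<noteq> 0"
    proof (cases "Suc k < ?n")
      case True
      then show ?thesis using adj[OF True] by (auto simp: cross_def)
    next
      case False
      with k have "k = ?n - 1" by simp
      then show ?thesis using fl by (metis vector_2(1) zero_index zero_neq_one)
    qed
    then have "f ! k $ 1 \<noteq> 0 \<or> f ! k $ 2 \<noteq> 0" by (auto simp: vec_eq_iff forall_2)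
    then show ?thesis using nn[OF k] by (auto simp: s_def)
  qed
  define i where "i = (LEAST i. Suc i < ?n \<and> s (f ! Suc i) \<le> s (f ! i))"
  \<comment> \<open>A weak descent exists: the last entry has sum 1, the least possible value, so
    the final step is one.\<close>
  have "Suc (?n - 2) < ?n \<and> s (f ! Suc (?n - 2)) \<le> s (f ! (?n - 2))"
  proof -
    have e: "Suc (?n - 2) = ?n - 1" using less.prems(1) by simp
    have "s (f ! Suc (?n - 2)) = 1" unfolding e fl by (simp add: s_def)
    moreover have "?n - 2 < ?n" "Suc (?n - 2) < ?n" using less.prems(1) by linarith+
    ultimately show ?thesis using spos[of "?n - 2"] by simp
  qed
  then have i: "Suc i < ?n" "s (f ! Suc i) \<le> s (f ! i)"
    unfolding i_def by (metis (mono_tags, lifting) LeastI)+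
  have least: "s (f ! k) < s (f ! Suc k)" if "k < i" for k
    using not_less_Least[of k "\<lambda>i. Suc i < ?n \<and> s (f ! Suc i) \<le> s (f ! i)"] that i(1)
    unfolding i_def by auto
  \<comment> \<open>A descent at the very start would make the second entry (1,0), and unimodularity
    would then force a negative second coordinate on the third.\<close>
  have "i \<noteq> 0"
  proof
    assume "i = 0"
    then have "s (f ! 1) \<le> 1" using i(2) f0 by (simp add: s_def)
    moreover have "f ! 1 $ 1 = 1" using adj[of 0] f0 less.prems(1) by (simp add: cross_def)
    ultimately have "f ! 1 $ 2 = 0" using nn[of 1] less.prems(1) by (simp add: s_def)
    then show False
      using adj[of 1] nn[of 2] less.prems(1) \<open>f ! 1 $ 1 = 1\<close> by (simp add: cross_def numeral_2_eq_2)
  qed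
  then obtain j where j: "i = Suc j" by (cases i) auto
  define c where "c = cross (f ! j) (f ! Suc i)"
  have c: "f ! j + f ! Suc i = c *s (f ! i)"
    unfolding c_def using unimodular_neighbours adj[of j] adj[of i] i(1) j by simp
  then have "s (f ! j) + s (f ! Suc i) = c * s (f ! i)"
    by (simp add: s_def vec_eq_iff forall_2 algebra_simps)
  moreover have "s (f ! j) < s (f ! i)" using least[of j] j by simp
  moreover have "0 < s (f ! i)" "0 < s (f ! j)" "0 < s (f ! Suc i)"
    using spos i(1) j by simp_all
  \<comment> \<open>The two outer sums total more than 0 and less than twice the middle one, which
    leaves 1 as the only multiplier.\<close>
  ultimately have "0 * s (f ! i) < c * s (f ! i)" "c * s (f ! i) < 2 * s (f ! i)"
    using i(2) by linarith+
  then have "c = 1"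
    using \<open>0 < s (f ! i)\<close> by (simp only: mult_less_cancel_right_pos)
  then have sum: "f ! i = f ! j + f ! Suc i" using c by simp
  have "f = take j f @ f ! j # (f ! j + f ! Suc i) # f ! Suc i # drop (Suc (Suc i)) f"
    using i(1) j sum by (metis Cons_nth_drop_Suc Suc_lessD append_take_drop_id)
  then obtain us u w ws where f: "f = us @ u # (u + w) # w # ws" by blast
  show ?case
  proof (cases "?n = 3")
    case True
    then have "us = []" "ws = []" using f by auto
    then have "f = [vector [0, 1], vector [0, 1] + vector [1, 0], vector [1, 0]]"
      using f less.prems(4,5) by simp
    also have "vector [0, 1] + vector [1, 0] = (vector [1, 1] :: int ^ 2)"
      by (simp add: vec_eq_iff forall_2)
    finally show ?thesis using F_seq.base by simp
  next
    case False
    have "F_seq (us @ u # w # ws)"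
    proof (rule less.hyps)
      show "successively (\<lambda>v w. cross v w = 1) (us @ u # w # ws)"
        using less.prems(3) unfolding f by (auto simp: successively_append_iff successively_Cons)
      show "hd (us @ u # w # ws) = vector [0, 1]"
        using less.prems(4) unfolding f by (auto simp: hd_append)
    qed (use f False less.prems(1,2,5) in \<open>auto simp: Suc_le_eq\<close>)
    then show ?thesis using F_seq.insert f by metis
  qed
qed

text \<open>\<open>le_Q\<close> is antisymmetric only up to proportionality, so antisymmetry is
  asked on the entries alone. If the heads differed, each would precede the other.\<close>

lemma sorted_wrt_antisym_unique:
  assumes "sorted_wrt P xs" "sorted_wrt P ys" "distinct xs" "distinct ys" "set xs = set ys"
    and "\<And>x y. x \<in> set xs \<Longrightarrow> y \<in> set xs \<Longrightarrow> P x y \<Longrightarrow> P y x \<Longrightarrow> x = y"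
  shows "xs = ys"
  using assms
proof (induction xs arbitrary: ys)
  case (Cons x xs)
  then obtain y ys' where ys: "ys = y # ys'" by (cases ys) auto
  have "x = y"
  proof (rule ccontr)
    assume "x \<noteq> y"
    then have "x \<in> set ys'" "y \<in> set xs" using Cons.prems(5) ys by auto
    then have "P x y" "P y x" using Cons.prems(1,2) ys by auto
    then show False using Cons.prems(6) \<open>x \<noteq> y\<close> \<open>y \<in> set xs\<close> by auto
  qed
  moreover have "xs = ys'"
  proof (rule Cons.IH)
    show "set xs = set ys'"
      using Cons.prems(3-5) ys \<open>x = y\<close> by (metis distinct.simps(2) insert_ident list.set(2))
    show "u = v" if "u \<in> set xs" "v \<in> set xs" "P u v" "P v u" for u v
      using Cons.prems(6)[of u v] that by simp
  qed (use Cons.prems ys in auto)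
  ultimately show ?case using ys by simp
qed auto

lemma cross_pos_chain:
  assumes "\<And>k. k < n \<Longrightarrow> v k \<in> nonneg_vecs" "\<And>k. Suc k < n \<Longrightarrow> 0 < cross (v k) (v (Suc k))"
    and "j < k" "k < n"
  shows "0 < cross (v j) (v k)"
  using assms(3,4)
proof (induction k)
  case (Suc k)
  show ?case
  proof (cases "j = k")
    case True
    then show ?thesis using assms(2) Suc.prems by simp
  next
    case False
    then have "0 < cross (v j) (v k)" using Suc by simp
    then show ?thesis
      using cross_trans[of "v j" "v k" "v (Suc k)"] assms(1,2) Suc.prems by simp
  qed
qed simp

lemma nonneg_vecs_antisym: "v \<in> nonneg_vecs \<Longrightarrow> - v \<in> nonneg_vecs \<Longrightarrow> v = 0"
  by (auto simp: nonneg_vecs_def vec_eq_iff order_antisym)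

lemma nonneg_vecs_iff: "v \<in> nonneg_vecs \<longleftrightarrow> 0 \<le> v $ 1 \<and> 0 \<le> v $ 2"
  by (simp add: nonneg_vecs_def forall_2)

section \<open>Real roots along an alternating walk\<close>

text \<open>The alternation starts with 2 so that \<open>root_seq\<close> starts with (0,1), as an
  F-sequence does.\<close>

definition lab :: "nat \<Rightarrow> 2" where
  "lab k = (if even k then 2 else 1)"

lemma lab_simps [simp]: "lab 0 = 2" "lab (Suc 0) = 1" "lab (Suc (Suc k)) = lab k"
  "lab (Suc k) \<noteq> lab k" "lab k \<noteq> lab (Suc k)"
  by (auto simp: lab_def)

lemma lab_cases: "i = lab k \<or> i = lab (Suc k)"
  using exhaust_2[of i] by (auto simp: lab_def)

lemma simple_root_component [simp]: "simple_root i $ j = (if i = j then 1 else 0)"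
  by (simp add: simple_root_def axis_def)

lemma simple_root_nonneg [simp]: "simple_root i \<in> nonneg_vecs"
  by (simp add: nonneg_vecs_def)

lemma all_lab: "(\<forall>i. P i) \<longleftrightarrow> P (lab k) \<and> P (lab (Suc k))"
  by (metis lab_cases)

lemma vec_expansion:
  "v = v $ lab k *s simple_root (lab k) + v $ lab (Suc k) *s simple_root (lab (Suc k))"
  by (simp add: vec_eq_iff all_lab[of _ k])

lemma refl_map_lin:
  "refl_map C i a (x *s u + y *s v) = x *s refl_map C i a u + y *s refl_map C i a v"
  by (simp add: refl_map_def vec_eq_iff sum_2 algebra_simps)

primrec walk :: "'a cartan_data \<Rightarrow> 'a \<Rightarrow> nat \<Rightarrow> 'a" where
  "walk C a 0 = a"
| "walk C a (Suc k) = rho C (lab k) (walk C a k)"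

text \<open>Composes the reflections backwards along the walk, from \<open>walk C a k\<close> to \<open>a\<close>.\<close>

primrec walk_map :: "'a cartan_data \<Rightarrow> 'a \<Rightarrow> nat \<Rightarrow> int ^ 2 \<Rightarrow> int ^ 2" where
  "walk_map C a 0 = id"
| "walk_map C a (Suc k) = walk_map C a k \<circ> refl_map C (lab k) (walk C a (Suc k))"

definition root_seq :: "'a cartan_data \<Rightarrow> 'a \<Rightarrow> nat \<Rightarrow> int ^ 2" where
  "root_seq C a k = walk_map C a k (simple_root (lab k))"

lemma walk_map_lin:
  "walk_map C a k (x *s u + y *s v) = x *s walk_map C a k u + y *s walk_map C a k v"
  by (induction k arbitrary: u v) (simp_all add: refl_map_lin)

lemma walk_add_even: "even l \<Longrightarrow> walk C a (k + l) = walk C (walk C a l) k"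
  by (induction k) (auto simp: lab_def)

lemma one_neq_two: "(1 :: 2) \<noteq> 2"
  by simp

lemma nonneg_combinations:
  assumes "i \<noteq> j"
  shows "{int p *s simple_root i + int q *s simple_root j | p q. True} = nonneg_vecs"
proof
  have ij: "k = i \<or> k = j" for k
    using assms exhaust_2[of i] exhaust_2[of j] exhaust_2[of k] by auto
  show "nonneg_vecs \<subseteq> {int p *s simple_root i + int q *s simple_root j | p q. True}"
  proof
    fix v assume "v \<in> nonneg_vecs"
    then have "v $ k = (int (nat (v $ i)) *s simple_root i + int (nat (v $ j)) *s simple_root j) $ k" for k
      using assms ij[of k] by (auto simp: nonneg_vecs_def)
    then have "v = int (nat (v $ i)) *s simple_root i + int (nat (v $ j)) *s simple_root j"
      unfolding vec_eq_iff by blast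
    then show "v \<in> {int p *s simple_root i + int q *s simple_root j | p q. True}" by blast
  qed
qed (auto simp: nonneg_vecs_def)

text \<open>The base point is a parameter because the uniqueness proof moves it along walks;
  \<open>R\<close> is arbitrary, so the arguments rest on the axioms and not on
  \<open>real_roots\<close>.\<close>

locale based_root_system =
  fixes C :: "'a cartan_data" and R :: "'a \<Rightarrow> (int ^ 2) set" and a :: 'a
  assumes scheme: "cartan_scheme C" and fin: "finite_root_system C R" and base: "a \<in> objs C"
begin

lemma rho_closed [simp]: "b \<in> objs C \<Longrightarrow> rho C i b \<in> objs C"
  using scheme unfolding cartan_scheme_def by blast

lemma rho_rho [simp]: "b \<in> objs C \<Longrightarrow> rho C i (rho C i b) = b"
  using scheme unfolding cartan_scheme_def by blast

lemma cartan_matrix: "b \<in> objs C \<Longrightarrow> gen_cartan_matrix (cmat C b)"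
  using scheme unfolding cartan_scheme_def by blast

lemma cmat_diag [simp]: "b \<in> objs C \<Longrightarrow> cmat C b $ i $ i = 2"
  using cartan_matrix unfolding gen_cartan_matrix_def by blast

lemma cmat_offdiag: "b \<in> objs C \<Longrightarrow> i \<noteq> j \<Longrightarrow> cmat C b $ i $ j \<le> 0"
  using cartan_matrix unfolding gen_cartan_matrix_def by blast

lemma cmat_rho [simp]: "b \<in> objs C \<Longrightarrow> cmat C (rho C i b) $ i $ j = cmat C b $ i $ j"
  using scheme unfolding cartan_scheme_def by metis

lemma walk_closed [simp]: "walk C a k \<in> objs C"
  by (induction k) (simp_all add: base)

lemma finite_roots: "b \<in> objs C \<Longrightarrow> finite (R b)"
  using fin by (simp add: finite_root_system_def)

lemma root_system: "root_system C R"
  using fin by (simp add: finite_root_system_def)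

lemma root_sign_split: "b \<in> objs C \<Longrightarrow> R b = (R b \<inter> nonneg_vecs) \<union> uminus ` (R b \<inter> nonneg_vecs)"
  using root_system unfolding root_system_def by blast

lemma root_sign:
  assumes "b \<in> objs C" "v \<in> R b"
  shows "v \<in> nonneg_vecs \<or> - v \<in> nonneg_vecs"
proof -
  have "v \<in> (R b \<inter> nonneg_vecs) \<union> uminus ` (R b \<inter> nonneg_vecs)"
    using root_sign_split[OF assms(1)] assms(2) by metis
  then show ?thesis by auto
qed

lemma root_multiple: "b \<in> objs C \<Longrightarrow> x *s simple_root i \<in> R b \<longleftrightarrow> x = 1 \<or> x = -1"
proof -
  assume "b \<in> objs C"
  then have "R b \<inter> range (\<lambda>k. k *s simple_root i) = {simple_root i, - simple_root i}"
    using root_system unfolding root_system_def by blast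
  moreover have "x *s simple_root i \<in> R b \<longleftrightarrow> x *s simple_root i \<in> R b \<inter> range (\<lambda>k. k *s simple_root i)"
    by blast
  moreover have "x *s simple_root i = simple_root i \<longleftrightarrow> x = 1"
    "x *s simple_root i = - simple_root i \<longleftrightarrow> x = -1"
    by (auto simp: vec_eq_iff)
  ultimately show ?thesis by auto
qed

lemma simple_root_in: "b \<in> objs C \<Longrightarrow> simple_root i \<in> R b"
  using root_multiple[of b 1 i] by simp

lemma refl_image: "b \<in> objs C \<Longrightarrow> refl_map C i b ` R b = R (rho C i b)"
  using root_system unfolding root_system_def by blast

section \<open>Roots along the walk and their recursion\<close>

lemma walk_map_image: "walk_map C a k ` R (walk C a k) = R a"
proof (induction k)
  case (Suc k)
  have "refl_map C (lab k) (walk C a (Suc k)) ` R (walk C a (Suc k)) = R (walk C a k)"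
    by (subst refl_image) simp_all
  then show ?case using Suc by (metis image_comp walk_map.simps(2))
qed simp

lemma walk_map_prev: "walk_map C a (Suc k) (simple_root (lab k)) = - root_seq C a k"
proof -
  have "walk_map C a (Suc k) (simple_root (lab k))
      = walk_map C a k ((-1) *s simple_root (lab k) + 0 *s simple_root (lab k))"
    by (simp add: refl_map_simple_root) (rule arg_cong[where f = "walk_map C a k"], simp add: vec_eq_iff)
  then show ?thesis unfolding walk_map_lin by (simp add: root_seq_def vec_eq_iff)
qed

text \<open>The last reflection negates \<open>simple_root (lab k)\<close>, so the map carries the
  simple roots to \<open>root_seq C a (Suc k)\<close> and \<open>- root_seq C a k\<close>. Pulling a
  root back thus reads off its coordinates in this basis, and (R1) gives them one sign.\<close>

lemma walk_map_Suc_expansion: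
  "walk_map C a (Suc k) v = v $ lab (Suc k) *s root_seq C a (Suc k) - v $ lab k *s root_seq C a k"
proof -
  have "walk_map C a (Suc k) v = walk_map C a (Suc k)
      (v $ lab (Suc k) *s simple_root (lab (Suc k)) + v $ lab k *s simple_root (lab k))"
    using vec_expansion[of v "Suc k"] unfolding lab_simps(3) by (rule arg_cong)
  also have "\<dots> = v $ lab (Suc k) *s root_seq C a (Suc k) + v $ lab k *s (- root_seq C a k)"
    unfolding walk_map_lin walk_map_prev root_seq_def by (rule refl)
  also have "\<dots> = v $ lab (Suc k) *s root_seq C a (Suc k) - v $ lab k *s root_seq C a k"
    by (simp add: vec_eq_iff)
  finally show ?thesis .
qed

lemma root_seq_0: "root_seq C a 0 = vector [0, 1]"
  by (simp add: root_seq_def simple_root_vector)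

lemma root_seq_1: "root_seq C a (Suc 0) = vector [1, - cmat C a $ 2 $ 1]"
  by (simp add: root_seq_def refl_map_simple_root base vec_eq_iff forall_2)

text \<open>The outermost new reflection is expanded on the simple root that it does not negate; its
  Cartan row is the same at both ends of the edge.\<close>

lemma root_seq_rec:
  "root_seq C a (Suc (Suc k)) =
     - cmat C (walk C a (Suc k)) $ lab (Suc k) $ lab k *s root_seq C a (Suc k) - root_seq C a k"
proof -
  have "root_seq C a (Suc (Suc k)) = walk_map C a (Suc k)
      (refl_map C (lab (Suc k)) (walk C a (Suc (Suc k))) (simple_root (lab k)))"
    unfolding root_seq_def walk_map.simps(2)[of C a "Suc k"] by simp
  also have "\<dots> = - cmat C (walk C a (Suc k)) $ lab (Suc k) $ lab k *s root_seq C a (Suc k) - root_seq C a k"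
    unfolding refl_map_simple_root walk_map_Suc_expansion walk.simps(2)[of C a "Suc k"]
    by (simp add: vec_eq_iff del: walk.simps)
  finally show ?thesis .
qed

lemma root_seq_unimodular: "cross (root_seq C a k) (root_seq C a (Suc k)) = 1"
proof (induction k)
  case (Suc k)
  then show ?case
    unfolding root_seq_rec diff_conv_add_uminus by (simp add: cross_commute[of _ "root_seq C a k"] del: add_uminus_conv_diff)
qed (simp add: root_seq_0 root_seq_1 cross_def)

lemma root_seq_in: "root_seq C a k \<in> R a"
  using walk_map_image[of k] simple_root_in[OF walk_closed] unfolding root_seq_def by blast

lemma root_seq_nonzero: "root_seq C a k \<noteq> 0"
  using root_seq_unimodular[of k] by (auto simp: cross_def)

lemma root_seq_ex_neg: "\<exists>k. root_seq C a k \<notin> nonneg_vecs"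
proof (rule ccontr)
  assume "\<not> ?thesis"
  then have pos: "0 < cross (root_seq C a j) (root_seq C a k)" if "j < k" for j k
    using cross_pos_chain[of "Suc k" "root_seq C a" j k] that by (simp add: root_seq_unimodular)
  have "inj (root_seq C a)"
  proof (rule injI, rule ccontr)
    fix j k assume "root_seq C a j = root_seq C a k" "j \<noteq> k"
    then show False using pos[of j k] pos[of k j] by (cases "j < k") auto
  qed
  then have "infinite (range (root_seq C a))" by (simp add: finite_image_iff)
  moreover have "range (root_seq C a) \<subseteq> R a" using root_seq_in by blast
  ultimately show False using finite_roots[OF base] finite_subset by blast
qed

section \<open>The first sign change and the positive roots before it\<close>

definition nroots :: nat where
  "nroots = (LEAST k. root_seq C a k \<notin> nonneg_vecs)"

lemma root_seq_nonneg: "k < nroots \<Longrightarrow> root_seq C a k \<in> nonneg_vecs"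
  using not_less_Least nroots_def by auto

lemma root_seq_nroots_neg: "root_seq C a nroots \<notin> nonneg_vecs"
  unfolding nroots_def using root_seq_ex_neg by (metis LeastI)

lemma nroots_gt_1: "1 < nroots"
proof -
  have "root_seq C a 0 \<in> nonneg_vecs" "root_seq C a (Suc 0) \<in> nonneg_vecs"
    using cmat_offdiag[OF base, of 2 1] by (simp_all add: root_seq_0 root_seq_1 nonneg_vecs_iff)
  then show ?thesis using root_seq_nroots_neg
    by (metis One_nat_def less_one linorder_neqE_nat)
qed

lemma root_seq_pos: "j < k \<Longrightarrow> k < nroots \<Longrightarrow> 0 < cross (root_seq C a j) (root_seq C a k)"
  using cross_pos_chain[of nroots "root_seq C a"] root_seq_nonneg root_seq_unimodular by simp

text \<open>At the first sign change both \<open>u\<close> and \<open>w\<close> lie in the positive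
  quadrant. A simple root pulls back to a root with coordinates of one sign, so each simple root is
  a non-negative combination of \<open>u\<close> and \<open>w\<close>; this is possible only if
  these two are themselves the simple roots.\<close>

lemma root_seq_ends:
  "root_seq C a (nroots - 1) = vector [1, 0]" "root_seq C a nroots = - vector [0, 1]"
proof -
  obtain p where p: "nroots = Suc p" using nroots_gt_1 by (cases nroots) auto
  define u w where "u = - root_seq C a nroots" and "w = root_seq C a p"
  have nn: "u \<in> nonneg_vecs" "w \<in> nonneg_vecs"
    using root_seq_nroots_neg root_sign[OF base root_seq_in] root_seq_nonneg p
    by (auto simp: u_def w_def)
  have uw: "cross u w = 1"
    using root_seq_unimodular[of p] by (simp add: u_def w_def p cross_commute[of _ "root_seq C a p"])
  have comb: "\<exists>x y. 0 \<le> x \<and> 0 \<le> y \<and> simple_root i = x *s u + y *s w" for i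
  proof -
    obtain v where v: "v \<in> R (walk C a nroots)" "simple_root i = walk_map C a nroots v"
      using walk_map_image[of nroots] simple_root_in[OF base, of i] by blast
    have e: "simple_root i = (- v $ lab nroots) *s u + (- v $ lab p) *s w"
      unfolding v(2) by (simp add: p walk_map_Suc_expansion u_def w_def vec_eq_iff del: walk_map.simps)
    have "v \<notin> nonneg_vecs"
    proof
      assume v: "v \<in> nonneg_vecs"
      have "- simple_root i = v $ lab nroots *s u + v $ lab p *s w"
        unfolding e by (simp add: vec_eq_iff)
      also have "\<dots> \<in> nonneg_vecs" using v nn by (simp add: nonneg_vecs_def)
      finally show False by (auto simp: nonneg_vecs_def dest: spec[of _ i])
    qed
    then have "- v \<in> nonneg_vecs" using root_sign[OF walk_closed v(1)] by simp
    then show ?thesis using e unfolding nonneg_vecs_def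
      by (metis mem_Collect_eq vector_uminus_component)
  qed
  have pos: "0 \<le> u $ 1" "0 \<le> w $ 2" "0 < w $ 1" "0 < u $ 2"
    using nn uw by (auto simp: cross_def nonneg_vecs_iff)
      (smt (verit) mult_nonneg_nonneg mult_eq_0_iff)+
  obtain x y where xy: "0 \<le> x" "0 \<le> y" "simple_root 1 = x *s u + y *s w" using comb by blast
  then have e1: "x * u $ 1 + y * w $ 1 = 1" "x * u $ 2 + y * w $ 2 = 0"
    by (simp_all add: vec_eq_iff forall_2)
  then have "x = 0" using xy(1,2) pos by (smt (verit) mult_nonneg_nonneg mult_pos_pos)
  then have w: "w $ 1 = 1" "w $ 2 = 0" using e1 xy(2) pos
    by (auto simp: zmult_eq_1_iff)
  obtain x' y' where xy': "0 \<le> x'" "0 \<le> y'" "simple_root 2 = x' *s u + y' *s w" using comb by blast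
  then have e2: "x' * u $ 1 + y' * w $ 1 = 0" "x' * u $ 2 + y' * w $ 2 = 1"
    by (simp_all add: vec_eq_iff forall_2)
  then have "y' = 0" using xy'(1,2) pos by (smt (verit) mult_nonneg_nonneg mult_pos_pos)
  then have u: "u $ 1 = 0" "u $ 2 = 1" using e2 xy'(1) pos
    by (auto simp: zmult_eq_1_iff)
  show "root_seq C a (nroots - 1) = vector [1, 0]"
    using w p by (simp add: w_def vec_eq_iff forall_2)
  have "root_seq C a nroots = - u" by (simp add: u_def)
  then show "root_seq C a nroots = - vector [0, 1]"
    using u by (simp add: vec_eq_iff forall_2)
qed

text \<open>
  A positive root strictly between \<open>\<beta>\<^sub>k\<close> and \<open>\<beta>\<^bsub>k+1\<^esub>\<close> would be pulled back by the walk map to a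
  vector with coordinates of opposite signs.
\<close>

lemma positive_roots: "R a \<inter> nonneg_vecs = root_seq C a ` {..<nroots}"
proof
  show "root_seq C a ` {..<nroots} \<subseteq> R a \<inter> nonneg_vecs"
    using root_seq_in root_seq_nonneg by blast
  show "R a \<inter> nonneg_vecs \<subseteq> root_seq C a ` {..<nroots}"
  proof
    fix v assume "v \<in> R a \<inter> nonneg_vecs"
    then have v: "v \<in> R a" "0 \<le> v $ 1" "0 \<le> v $ 2" by (auto simp: nonneg_vecs_iff)
    \<comment> \<open>Meaningful in the first case below: \<open>v\<close> then comes strictly
      before \<open>root_seq C a (Suc k)\<close> but not before
      \<open>root_seq C a k\<close>.\<close>
    define k where "k = (LEAST k. cross (root_seq C a (Suc k)) v < 0)"
    show "v \<in> root_seq C a ` {..<nroots}"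
    proof (cases "\<exists>k. Suc k < nroots \<and> cross (root_seq C a (Suc k)) v < 0")
      case True
      then obtain k' where k': "Suc k' < nroots" "cross (root_seq C a (Suc k')) v < 0" by blast
      have k: "cross (root_seq C a (Suc k)) v < 0" "k \<le> k'"
        unfolding k_def using k'(2) by (auto intro: LeastI Least_le)
      have "0 \<le> cross (root_seq C a k) v"
      proof (cases k)
        case 0
        then show ?thesis using v by (simp add: root_seq_0 cross_def)
      next
        case (Suc l)
        then show ?thesis using not_less_Least[of l] unfolding k_def by (metis lessI not_less)
      qed
      obtain z where z: "z \<in> R (walk C a (Suc k))" "v = walk_map C a (Suc k) z"
        using walk_map_image[of "Suc k"] v(1) by blast
      have "cross (root_seq C a k) v = z $ lab (Suc k)"
        "cross (root_seq C a (Suc k)) v = z $ lab k"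
        unfolding z(2) walk_map_Suc_expansion using root_seq_unimodular[of k]
        by (simp_all add: cross_def algebra_simps)
      with k(1) \<open>0 \<le> cross (root_seq C a k) v\<close> have zs: "z $ lab k < 0" "0 \<le> z $ lab (Suc k)" by auto
      \<comment> \<open>(R1) excludes coordinates of opposite signs, so the non-negative one
        vanishes; (R2) then applies to a multiple of a simple root.\<close>
      with root_sign[OF walk_closed z(1)] have "z $ lab (Suc k) = 0"
        by (auto simp: nonneg_vecs_def not_le[symmetric]) (metis neg_0_le_iff_le order_antisym)
      then have e: "z = z $ lab k *s simple_root (lab k)"
        by (simp add: vec_eq_iff all_lab[of _ k])
      then have "z $ lab k *s simple_root (lab k) \<in> R (walk C a (Suc k))"
        using z(1) by metis
      then have "z $ lab k = -1"
        using root_multiple[OF walk_closed, of "z $ lab k" "lab k" "Suc k"] zs(1) by linarith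
      then have "v = root_seq C a k"
        unfolding z(2) walk_map_Suc_expansion using \<open>z $ lab (Suc k) = 0\<close> by (simp add: vec_eq_iff)
      then show ?thesis using k k' by simp
    next
      case False
      moreover have "Suc (nroots - 2) < nroots" "Suc (nroots - 2) = nroots - 1"
        using nroots_gt_1 by linarith+
      ultimately have "0 \<le> cross (root_seq C a (nroots - 1)) v" by (metis not_less)
      then have "v $ 2 = 0" unfolding root_seq_ends using v by (simp add: cross_def)
      then have e: "v = v $ 1 *s simple_root 1" by (simp add: vec_eq_iff forall_2)
      then have "v $ 1 *s simple_root 1 \<in> R a" using v(1) by metis
      then have "v $ 1 = 1" using root_multiple[OF base, of "v $ 1" 1] v(2) by linarith
      then have "v = root_seq C a (nroots - 1)"
        unfolding root_seq_ends using \<open>v $ 2 = 0\<close> by (simp add: vec_eq_iff forall_2)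
      then show ?thesis using nroots_gt_1 by auto
    qed
  qed
qed

lemma inj_root_seq: "inj_on (root_seq C a) {..<nroots}"
proof (rule inj_onI, rule ccontr)
  fix j k assume *: "j \<in> {..<nroots}" "k \<in> {..<nroots}" "root_seq C a j = root_seq C a k" "j \<noteq> k"
  then show False using root_seq_pos[of j k] root_seq_pos[of k j] by (cases "j < k") auto
qed

lemma card_positive_roots: "card (R a \<inter> nonneg_vecs) = nroots"
  by (simp add: positive_roots card_image inj_root_seq)

lemma walk_double: "walk C a (2 * k) = ((rho C 1 \<circ> rho C 2) ^^ k) a"
  by (induction k) (simp_all add: lab_def)

text \<open>This is (R4) for the indices 1 and 2: its exponent is the number of positive roots, and
  each application of \<open>rho C 1 \<circ> rho C 2\<close> makes two steps of the walk.\<close>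

lemma walk_period: "walk C a (2 * nroots) = a"
proof -
  have "(let S = R a \<inter> {int p *s simple_root 1 + int q *s simple_root 2 | p q. True}
         in finite S \<longrightarrow> ((rho C 1 \<circ> rho C 2) ^^ card S) a = a)"
    using root_system base one_neq_two unfolding root_system_def by blast
  then show ?thesis
    unfolding nonneg_combinations[OF one_neq_two] Let_def walk_double
    using card_positive_roots finite_roots[OF base] by simp
qed

lemma walk_mod: "walk C a (k mod (2 * nroots)) = walk C a k"
proof -
  have "walk C a (k + q * (2 * nroots)) = walk C a k" for k q
  proof (induction q)
    case (Suc q)
    have "walk C a (k + Suc q * (2 * nroots)) = walk C a (k + q * (2 * nroots) + 2 * nroots)"
      by (simp add: algebra_simps)
    then show ?case using Suc by (simp add: walk_add_even walk_period)
  qed simp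
  from this[of "k mod (2 * nroots)" "k div (2 * nroots)"] show ?thesis
    unfolding mod_div_mult_eq by (rule sym)
qed

text \<open>With only two positive roots the second is both (1,0) and
  \<open>vector [1, - cmat C a $ 2 $ 1]\<close>, so the off-diagonal entries vanish and the matrix
  decomposes.\<close>

lemma nroots_gt_2:
  assumes "indecomposable (cmat C a)"
  shows "2 < nroots"
proof (rule ccontr)
  assume "\<not> 2 < nroots"
  with nroots_gt_1 have "nroots = 2" by simp
  then have "cmat C a $ 2 $ 1 = 0"
    using root_seq_ends(1) root_seq_1 by (simp add: vec_eq_iff forall_2)
  moreover have "cmat C a $ 1 $ 2 = 0"
    using cartan_matrix[OF base] calculation unfolding gen_cartan_matrix_def by blast
  ultimately have "\<forall>i\<in>{1}. \<forall>j\<in>- {1}. cmat C a $ i $ j = 0 \<and> cmat C a $ j $ i = 0"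
    by (metis ComplD exhaust_2 singletonD singletonI)
  moreover have "{1 :: 2} \<noteq> UNIV" by (metis UNIV_I one_neq_two singletonD)
  ultimately show False using assms unfolding indecomposable_def by blast
qed

lemma sorts_to_root_seq: "sorts_to (R a \<inter> nonneg_vecs) (map (root_seq C a) [0..<nroots])"
  by (auto simp: sorts_to_def positive_roots distinct_map lessThan_atLeast0[symmetric] inj_root_seq
      sorted_wrt_iff_nth_less le_Q_iff_cross root_seq_pos less_imp_le)

lemma sorts_to_unique:
  assumes "sorts_to (R a \<inter> nonneg_vecs) vs"
  shows "vs = map (root_seq C a) [0..<nroots]"
proof (rule sorted_wrt_antisym_unique[where P = le_Q])
  fix v w assume "v \<in> set vs" "w \<in> set vs" "le_Q v w" "le_Q w v"
  then obtain j k where jk: "v = root_seq C a j" "w = root_seq C a k" "j < nroots" "k < nroots"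
    and "cross v w = 0"
    using assms by (auto simp: sorts_to_def positive_roots le_Q_iff_cross cross_commute[of w v])
  then show "v = w"
    using root_seq_pos[of j k] root_seq_pos[of k j] cross_commute[of w v] by (cases j k rule: linorder_cases) auto
qed (use assms sorts_to_root_seq in \<open>auto simp: sorts_to_def\<close>)

lemma F_seq_root_seq:
  assumes "indecomposable (cmat C a)"
  shows "F_seq (map (root_seq C a) [0..<nroots])"
proof (rule F_seqI)
  show "set (map (root_seq C a) [0..<nroots]) \<subseteq> nonneg_vecs"
    using root_seq_nonneg by auto
  show "successively (\<lambda>v w. cross v w = 1) (map (root_seq C a) [0..<nroots])"
    by (simp add: successively_conv_nth root_seq_unimodular)
qed (use nroots_gt_2[OF assms] in \<open>auto simp: hd_map last_map root_seq_0 root_seq_ends(1)[unfolded One_nat_def]\<close>)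

end

section \<open>Uniqueness\<close>

lemma refl_map_in_Hom: "b \<in> objs C \<Longrightarrow> refl_map C i b \<in> Hom C b (rho C i b)"
  using weyl_paths.comp[OF weyl_paths.id, of b C i] by (simp add: Hom_def)

lemma Hom_comp:
  assumes "\<phi> \<in> Hom C a b" "\<psi> \<in> Hom C b c"
  shows "\<psi> \<circ> \<phi> \<in> Hom C a c"
proof -
  have "(c, \<psi>) \<in> weyl_paths C b" "(b, \<phi>) \<in> weyl_paths C a"
    using assms by (auto simp: Hom_def)
  then have "(c, \<psi> \<circ> \<phi>) \<in> weyl_paths C a"
  proof (induction rule: weyl_paths.induct)
    case (comp c \<psi> i)
    then show ?case by (metis comp_assoc weyl_paths.comp)
  qed simp
  then show ?thesis by (simp add: Hom_def)
qed

lemma (in based_root_system) walk_map_in_Hom: "walk_map C a k \<in> Hom C (walk C a k) a"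
proof (induction k)
  case 0
  show ?case using weyl_paths.id[OF base] by (simp only: Hom_def walk.simps walk_map.simps mem_Collect_eq)
next
  case (Suc k)
  have "refl_map C (lab k) (walk C a (Suc k)) \<in> Hom C (walk C a (Suc k)) (walk C a k)"
    using refl_map_in_Hom[of "walk C a (Suc k)" C "lab k"] by simp
  from Hom_comp[OF this Suc] show ?case by (simp only: walk_map.simps)
qed

section \<open>The object set as a cycle of length \<open>2 * nroots\<close>\<close>

locale simply_connected_root_system = based_root_system C R a for C :: "'a cartan_data" and R a +
  assumes connected: "connected_scheme C" and simply_connected: "simply_connected_scheme C"
begin

text \<open>The reflection at a fixed point would be an endomorphism, hence the identity, yet it
  negates \<open>simple_root i\<close>.\<close>

lemma rho_no_fixpoint: "b \<in> objs C \<Longrightarrow> rho C i b \<noteq> b"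
proof
  assume b: "b \<in> objs C" "rho C i b = b"
  then have "refl_map C i b \<in> {id}"
    using refl_map_in_Hom[OF b(1), of i] simply_connected unfolding simply_connected_scheme_def by metis
  then have "refl_map C i b (simple_root i) $ i = 1" by simp
  then show False using b(1) by (simp add: refl_map_simple_root)
qed

text \<open>A return would make \<open>walk_map\<close> the identity, but it sends a simple root to
  the negative of \<open>root_seq C a (k - 1)\<close>, which is a positive root as long as
  \<open>k \<le> nroots\<close>.\<close>

lemma walk_eq_base_small:
  assumes "0 < k" "k \<le> nroots"
  shows "walk C a k \<noteq> a"
proof
  obtain l where k: "k = Suc l" using assms by (cases k) auto
  assume "walk C a k = a"
  then have "walk_map C a k \<in> {id}"
    using walk_map_in_Hom[of k] simply_connected base unfolding simply_connected_scheme_def by metis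
  then have "- root_seq C a l \<in> nonneg_vecs"
    using walk_map_prev[of l] unfolding k by (metis id_apply simple_root_nonneg singletonD)
  then show False
    using root_seq_nonneg[of l] root_seq_nonzero[of l] nonneg_vecs_antisym assms k by auto
qed

text \<open>Positions of equal parity are entered through edges of equal label, so the last steps
  cancel one after another.\<close>

lemma walk_backward:
  assumes "even (l - k)" "k \<le> l" "walk C a k = walk C a l"
  shows "walk C a (l - k) = a"
  using assms
proof (induction k arbitrary: l)
  case (Suc k)
  then obtain m where l: "l = Suc m" by (cases l) auto
  have "lab m = lab k" using Suc.prems(1,2) l by (auto simp: lab_def)
  then have "walk C a k = walk C a m"
    using Suc.prems(3) rho_rho[OF walk_closed] unfolding l by (metis walk.simps(2))
  then show ?case using Suc.IH[of m] Suc.prems l by simp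
qed simp

text \<open>A walk of odd length returning to its start folds onto a fixed point of some \<open>\<rho>\<^sub>i\<close>.\<close>

lemma walk_odd:
  assumes "walk C a k = walk C a (Suc (k + 2 * m))"
  shows False
  using assms
proof (induction m arbitrary: k)
  case 0
  then show ?case using rho_no_fixpoint[OF walk_closed] by (metis add_0_right mult_0_right walk.simps(2))
next
  case (Suc m)
  let ?l = "Suc (Suc (k + 2 * m))"
  have "lab ?l = lab k" by (simp add: lab_def)
  moreover have "walk C a k = rho C (lab ?l) (walk C a ?l)"
    using Suc.prems by simp
  ultimately have "walk C a (Suc k) = walk C a ?l"
    using rho_rho[OF walk_closed] by (metis walk.simps(2))
  then show ?case using Suc.IH[of "Suc k"] by simp
qed

text \<open>An even gap \<open>d\<close> gives returns to \<open>a\<close> after \<open>d\<close>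
  and after \<open>2 * nroots - d\<close> steps, one of which is at most
  \<open>nroots\<close>.\<close>

lemma walk_less_neq:
  assumes "k < l" "l < 2 * nroots"
  shows "walk C a k \<noteq> walk C a l"
proof
  assume eq: "walk C a k = walk C a l"
  show False
  proof (cases "even (l - k)")
    case True
    define d where "d = l - k"
    have d: "walk C a d = a" "0 < d" "d < 2 * nroots" "even d"
      using walk_backward[OF True _ eq] assms True by (auto simp: d_def)
    have "walk C a (2 * nroots - d) = walk C a (2 * nroots - d + d)"
      using walk_add_even[OF d(4)] d(1) by metis
    then have "walk C a (2 * nroots - d) = a" using d(3) walk_period by simp
    then show False
      using walk_eq_base_small[of d] walk_eq_base_small[of "2 * nroots - d"] d by linarith
  next
    case False
    then obtain m where "l - k = 2 * m + 1" by (rule oddE)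
    then have "l = Suc (k + 2 * m)" using assms by simp
    then show False using walk_odd eq by simp
  qed
qed

lemma bij_walk: "bij_betw (walk C a) {..<2 * nroots} (objs C)"
proof (rule bij_betw_imageI)
  show "inj_on (walk C a) {..<2 * nroots}"
    by (rule inj_onI) (metis lessThan_iff linorder_neqE_nat walk_less_neq)
  have reach: "c \<in> walk C a ` {..<2 * nroots}" if "(c, \<phi>) \<in> weyl_paths C a" for c \<phi>
    using that
  proof induction
    case id
    have "a = walk C a 0" by simp
    then show ?case using nroots_gt_1 by (metis imageI lessThan_iff less_trans mult_pos_pos zero_less_numeral zero_less_one)
  next
    case (comp b \<phi> i)
    then obtain k where "b = walk C a k" by blast
    \<comment> \<open>Adding a period provides a predecessor even for the base point, so that one
      generator leads back and the other forward along the walk.\<close>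
    then have "b = walk C a (Suc (k + 2 * nroots - 1))"
      using nroots_gt_1 by (simp add: walk_add_even walk_period del: walk.simps)
    then obtain l where b: "b = walk C a (Suc l)" by blast
    have "\<exists>m. rho C i b = walk C a m"
    proof (cases "i = lab l")
      case True
      then show ?thesis using b rho_rho[OF walk_closed] by (metis walk.simps(2))
    next
      case False
      then have "i = lab (Suc l)" using lab_cases[of i l] by blast
      then show ?thesis using b by (metis walk.simps(2))
    qed
    then obtain m where "rho C i b = walk C a (m mod (2 * nroots))" by (metis walk_mod)
    then show ?case using nroots_gt_1 by (metis imageI lessThan_iff mod_less_divisor mult_pos_pos zero_less_numeral less_trans zero_less_one)
  qed
  show "walk C a ` {..<2 * nroots} = objs C"
  proof
    show "objs C \<subseteq> walk C a ` {..<2 * nroots}"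
      using connected base reach unfolding connected_scheme_def Hom_def by blast
  qed auto
qed

end

text \<open>\<open>simple_root j - cmat C a $ i $ j *s simple_root i\<close> is a root at
  \<open>a\<close>, hence at \<open>b\<close>. Reflecting it in \<open>D\<close> leaves coefficient
  1 at \<open>j\<close>, so by (R1) its coefficient at \<open>i\<close>, the difference of the two
  entries, is non-negative.\<close>

lemma cmat_le:
  assumes "based_root_system C R a" "based_root_system D S b" "R a = S b" "i \<noteq> j"
  shows "cmat D b $ i $ j \<le> cmat C a $ i $ j"
proof -
  interpret C: based_root_system C R a by fact
  interpret D: based_root_system D S b by fact
  let ?v = "refl_map C i (rho C i a) (simple_root j)"
  have "?v \<in> refl_map C i (rho C i a) ` R (rho C i a)"
    using C.simple_root_in[of "rho C i a" j] C.base by simp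
  also have "\<dots> = S b" using C.refl_image[of "rho C i a" i] C.base assms(3) by simp
  finally have "refl_map D i b ?v \<in> S (rho D i b)" using D.refl_image[OF D.base, of i] by blast
  then have "refl_map D i b ?v \<in> nonneg_vecs \<or> - refl_map D i b ?v \<in> nonneg_vecs"
    using D.root_sign[OF D.rho_closed[OF D.base]] by blast
  moreover have v: "?v = 1 *s simple_root j + (- cmat C a $ i $ j) *s simple_root i"
    using C.base by (simp add: refl_map_simple_root vec_eq_iff)
  have "refl_map D i b ?v $ j = 1" "refl_map D i b ?v $ i = cmat C a $ i $ j - cmat D b $ i $ j"
    unfolding v refl_map_lin using D.base assms(4) by (auto simp: refl_map_simple_root)
  ultimately show ?thesis
    by (auto simp: nonneg_vecs_def dest: spec[of _ i] spec[of _ j])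
qed

lemma cmat_determined:
  assumes "based_root_system C R a" "based_root_system D S b" "R a = S b"
  shows "cmat C a = cmat D b"
proof -
  interpret C: based_root_system C R a by fact
  interpret D: based_root_system D S b by fact
  have "cmat C a $ i $ j = cmat D b $ i $ j" for i j
    using cmat_le[OF assms, of i j] cmat_le[OF assms(2,1), of i j] assms(3) C.base D.base
    by (cases "i = j") auto
  then show ?thesis by (simp add: vec_eq_iff)
qed

text \<open>Equal root sets give equal Cartan matrices and thus equal reflections, so equality
  propagates along the two walks. Matching the walks step by step is the equivalence, with the
  identity on indices.\<close>

lemma realized_schemes_equivalent:
  fixes C :: "'a cartan_data" and D :: "'b cartan_data"
  assumes "simply_connected_root_system C R a" "simply_connected_root_system D S b"
    and pos: "R a \<inter> nonneg_vecs = S b \<inter> nonneg_vecs"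
  shows "equivalent_schemes C D"
proof -
  interpret C: simply_connected_root_system C R a by fact
  interpret D: simply_connected_root_system D S b by fact
  have n: "C.nroots = D.nroots"
    using C.card_positive_roots D.card_positive_roots pos by simp
  have "R a = S b"
    using C.root_sign_split[OF C.base] D.root_sign_split[OF D.base] pos by metis
  have based: "based_root_system C R (walk C a k)" "based_root_system D S (walk D b k)" for k
    using C.scheme C.fin D.scheme D.fin by (auto intro: based_root_system.intro)
  have roots: "R (walk C a k) = S (walk D b k)" for k
  proof (induction k)
    case (Suc k)
    have "refl_map C (lab k) (walk C a k) = refl_map D (lab k) (walk D b k)"
      using cmat_determined[OF based Suc] by (simp add: refl_map_def fun_eq_iff)
    then show ?case
      using C.refl_image[OF C.walk_closed, of "lab k" k] D.refl_image[OF D.walk_closed, of "lab k" k] Suc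
      by simp
  qed (simp add: \<open>R a = S b\<close>)
  define N where "N = 2 * C.nroots"
  define \<phi> where "\<phi> = walk D b \<circ> inv_into {..<N} (walk C a)"
  have bij: "bij_betw (walk C a) {..<N} (objs C)" "bij_betw (walk D b) {..<N} (objs D)"
    using C.bij_walk D.bij_walk by (simp_all add: N_def n)
  have "N > 0" using C.nroots_gt_1 by (simp add: N_def)
  have mod: "walk C a (k mod N) = walk C a k" "walk D b (k mod N) = walk D b k" for k
    using C.walk_mod D.walk_mod by (simp_all add: N_def n)
  have \<phi>: "\<phi> (walk C a k) = walk D b k" for k
  proof -
    have "\<phi> (walk C a (k mod N)) = walk D b (k mod N)"
      unfolding \<phi>_def using bij(1) \<open>N > 0\<close> by (simp add: bij_betw_def inv_into_f_f)
    then show ?thesis by (simp only: mod)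
  qed
  have ex: "\<exists>l. c = walk C a (Suc l)" if "c \<in> objs C" for c
  proof -
    have "c \<in> walk C a ` {..<N}" using bij_betw_imp_surj_on[OF bij(1)] that by simp
    then obtain k where k: "c = walk C a k" by (elim imageE)
    have "Suc (k + N - 1) = k + N" using \<open>N > 0\<close> by simp
    moreover have "walk C a (k + N) = walk C a k"
      using mod(1)[of "k + N"] mod(1)[of k] by simp
    ultimately show ?thesis using k by metis
  qed
  have "bij_betw \<phi> (objs C) (objs D)"
    unfolding \<phi>_def using bij bij_betw_inv_into bij_betw_trans by blast
  moreover have "\<phi> (rho C i c) = rho D i (\<phi> c)" if "c \<in> objs C" for i c
  proof -
    obtain l where c: "c = walk C a (Suc l)" using ex \<open>c \<in> objs C\<close> by blast
    show ?thesis
    proof (cases "i = lab l")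
      case True
      then have "rho C i c = walk C a l" "rho D i (walk D b (Suc l)) = walk D b l" by (simp_all add: c)
      then show ?thesis by (simp only: c \<phi>)
    next
      case False
      then have "i = lab (Suc l)" using lab_cases[of i l] by blast
      then have "rho C i c = walk C a (Suc (Suc l))" "rho D i (walk D b (Suc l)) = walk D b (Suc (Suc l))"
        by (simp_all add: c)
      then show ?thesis by (simp only: c \<phi>)
    qed
  qed
  moreover have "cmat C c = cmat D (\<phi> c)" if "c \<in> objs C" for c
  proof -
    obtain l where c: "c = walk C a (Suc l)" using ex \<open>c \<in> objs C\<close> by blast
    show ?thesis unfolding c \<phi> by (rule cmat_determined[OF based roots])
  qed
  ultimately show ?thesis
    unfolding equivalent_schemes_def by (intro exI[of _ id] exI[of _ \<phi>]) auto
qed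

lemma realizes_equivalent:
  assumes "realizes C f" "realizes D f"
  shows "equivalent_schemes C D"
proof -
  obtain a b where
    "simply_connected_root_system C (real_roots C) a" "set f = real_roots C a \<inter> nonneg_vecs"
    "simply_connected_root_system D (real_roots D) b" "set f = real_roots D b \<inter> nonneg_vecs"
    using assms
    unfolding realizes_def simply_connected_root_system_def based_root_system_def
      simply_connected_root_system_axioms_def by metis
  then show ?thesis using realized_schemes_equivalent by metis
qed

section \<open>Existence\<close>

lemma refl_map_component:
  assumes "cmat C a $ i $ i = 2" "i \<noteq> j"
  shows "refl_map C i a v $ i = - v $ i - cmat C a $ i $ j * v $ j" "refl_map C i a v $ j = v $ j"
  using assms exhaust_2[of i] exhaust_2[of j]
  by (auto simp: refl_map_def sum_2 simple_root_def axis_def algebra_simps)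

lemma refl_map_involution:
  assumes "cmat C a $ i $ i = 2" "cmat C b $ i = cmat C a $ i"
  shows "refl_map C i b (refl_map C i a v) = v"
proof -
  obtain j where ij: "i \<noteq> j" by (metis one_neq_two)
  then have all: "k = i \<or> k = j" for k
    using exhaust_2[of i] exhaust_2[of j] exhaust_2[of k] by auto
  have "refl_map C i b (refl_map C i a v) $ i = v $ i"
    "refl_map C i b (refl_map C i a v) $ j = v $ j"
    using assms ij by (simp_all add: refl_map_component)
  then have "refl_map C i b (refl_map C i a v) $ k = v $ k" for k
    using all[of k] by blast
  then show ?thesis by (simp add: vec_eq_iff)
qed

locale f_sequence =
  fixes f :: "(int ^ 2) list"
  assumes F_seq: "F_seq f"
begin

definition m :: nat where "m = length f"

definition N :: nat where "N = 2 * m"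

text \<open>Antiperiodic extension: one period of length \<open>N\<close> runs once around all
  roots, first the positive ones and then their negatives.\<close>

definition ent :: "nat \<Rightarrow> int ^ 2" where
  "ent k = (if even (k div m) then f ! (k mod m) else - f ! (k mod m))"

text \<open>Equals minus the entry before \<open>k\<close>, without leaving the natural numbers.\<close>

definition opp :: "nat \<Rightarrow> int ^ 2" where
  "opp k = ent (k + (m - 1))"

text \<open>
  The coefficient in \<open>ent (k + 1) = quid k * ent k - ent (k - 1)\<close>, that is, the quiddity cycle of the
  corresponding triangulated polygon.
\<close>

definition quid :: "nat \<Rightarrow> int" where
  "quid k = cross (ent (Suc k)) (opp k)"

text \<open>The coordinate change from object \<open>k\<close> to object 0: the two simple roots go
  to \<open>ent k\<close> and to the negative of the preceding entry.\<close>

definition frame :: "nat \<Rightarrow> int ^ 2 \<Rightarrow> int ^ 2" where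
  "frame k v = v $ lab k *s ent k + v $ lab (Suc k) *s opp k"

text \<open>
  The objects form a cycle of length \<open>2 m\<close>. The edge joining \<open>k\<close> and \<open>k + 1\<close> belongs to \<open>\<rho>\<^sub>i\<close> with
  \<open>i = lab k\<close> and carries the Cartan entry \<open>- quid k\<close> in row \<open>i\<close> at both of its ends.
\<close>

definition scheme :: "nat cartan_data" where
  "scheme = \<lparr>objs = {..<N},
     rho = (\<lambda>i x. if i = lab x then Suc x mod N else (x + N - 1) mod N),
     cmat = (\<lambda>x. \<chi> i j. if i = j then 2 else if i = lab x then - quid x else - quid (x + N - 1))\<rparr>"

section \<open>Determinants and recursion of the antiperiodic extension\<close>

lemma m_ge: "3 \<le> m"
  using F_seq_length[OF F_seq] by (simp add: m_def)

lemma N_pos: "0 < N"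
  using m_ge by (simp add: N_def)

lemma ent_small: "k < m \<Longrightarrow> ent k = f ! k"
  by (simp add: ent_def)

lemma ent_add_m: "ent (k + m) = - ent k"
  using m_ge by (simp add: ent_def)

lemma ent_ends: "ent 0 = vector [0, 1]" "ent (m - 1) = vector [1, 0]"
proof -
  have "f \<noteq> []" using m_ge by (auto simp: m_def)
  then show "ent 0 = vector [0, 1]" "ent (m - 1) = vector [1, 0]"
    using F_seq_unimodular[OF F_seq] m_ge
    by (simp_all add: ent_small hd_conv_nth last_conv_nth) (simp add: m_def)
qed

lemma ent_add: "ent (k + q * m) = (if even q then ent k else - ent k)"
proof (induction q)
  case (Suc q)
  have "ent (k + Suc q * m) = - ent (k + q * m)"
    unfolding ent_add_m[symmetric] by (simp add: algebra_simps)
  then show ?case using Suc by simp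
qed simp

lemma ent_add_N: "ent (k + q * N) = ent k"
  using ent_add[of k "2 * q"] by (simp add: N_def algebra_simps)

text \<open>Up to a common sign the only pair not contained in \<open>f\<close> is the seam from
  (1,0) to (0,-1), whose determinant is 1 as well.\<close>

lemma ent_unimodular: "cross (ent k) (ent (Suc k)) = 1"
proof -
  have small: "cross (ent k) (ent (Suc k)) = 1" if "k < m" for k
  proof (cases "Suc k < m")
    case True
    then show ?thesis
      using F_seq_unimodular[OF F_seq] by (simp add: ent_small successively_conv_nth m_def)
  next
    case False
    with that have k: "k = m - 1" "Suc k = 0 + m" by auto
    show ?thesis unfolding k(2) ent_add_m unfolding k(1) ent_ends by (simp add: cross_def)
  qed
  have "k = k mod m + k div m * m" "Suc k = Suc (k mod m) + k div m * m" by simp_all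
  then have "ent k = (if even (k div m) then ent (k mod m) else - ent (k mod m))"
    "ent (Suc k) = (if even (k div m) then ent (Suc (k mod m)) else - ent (Suc (k mod m)))"
    using ent_add by metis+
  then show ?thesis using small[of "k mod m"] m_ge by simp
qed

lemma ent_nonneg: "k < m \<Longrightarrow> ent k \<in> nonneg_vecs"
  using F_seq_nonneg[OF F_seq] nth_mem[of k f] by (auto simp: ent_small m_def)

text \<open>Entries less than half a period apart differ by less than a half turn. Across the seam,
  antiperiodicity and the antisymmetry of \<open>cross\<close> reduce the claim to two entries of
  \<open>f\<close> in reverse order.\<close>

lemma ent_pos:
  assumes "0 < j" "j < m"
  shows "0 < cross (ent k) (ent (k + j))"
proof -
  have less: "0 < cross (ent i) (ent l)" if "i < l" "l < m" for i l
    using cross_pos_chain[of m ent i l] that ent_nonneg ent_unimodular by simp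
  have small: "0 < cross (ent i) (ent (i + j))" if "i < m" for i
  proof (cases "i + j < m")
    case True
    then show ?thesis using less assms by simp
  next
    case False
    then have "i + j = i + j - m + m" "i + j - m < i" using assms by simp_all
    then show ?thesis using less[of "i + j - m" i] that ent_add_m[of "i + j - m"]
      by (simp add: cross_commute[of "ent i"])
  qed
  have "k = k mod m + k div m * m" "k + j = k mod m + j + k div m * m" by simp_all
  then have "ent k = (if even (k div m) then ent (k mod m) else - ent (k mod m))"
    "ent (k + j) = (if even (k div m) then ent (k mod m + j) else - ent (k mod m + j))"
    using ent_add by metis+
  then show ?thesis using small[of "k mod m"] m_ge by simp
qed

lemma opp_unimodular: "cross (ent k) (opp k) = 1"
proof -
  have "Suc (k + (m - 1)) = k + m" using m_ge by simp
  then have "cross (opp k) (- ent k) = 1"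
    using ent_unimodular[of "k + (m - 1)"] by (simp add: opp_def ent_add_m)
  then show ?thesis using cross_commute[of "ent k" "opp k"] by simp
qed

lemma opp_Suc: "opp (Suc k) = - ent k"
proof -
  have "Suc k + (m - 1) = k + m" using m_ge by simp
  then show ?thesis unfolding opp_def by (simp only: ent_add_m)
qed

lemma ent_Suc: "ent (Suc k) = quid k *s ent k + opp k"
proof -
  have "cross (- opp k) (ent k) = 1"
    using opp_unimodular[of k] by (simp add: cross_commute[of "opp k"])
  then have "- opp k + ent (Suc k) = quid k *s ent k"
    using unimodular_neighbours[OF _ ent_unimodular[of k], of "- opp k"]
    by (simp add: quid_def cross_commute[of "opp k"])
  then show ?thesis by (simp add: vec_eq_iff algebra_simps)
qed

text \<open>\<open>opp k\<close> lies \<open>m - 2\<close> places after \<open>ent (Suc k)\<close>,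
  and \<open>m - 2\<close> is strictly between 0 and \<open>m\<close> because \<open>f\<close> has
  at least three entries.\<close>

lemma quid_pos: "0 < quid k"
proof -
  have "k + (m - 1) = Suc k + (m - 2)" using m_ge by simp
  then show ?thesis
    unfolding quid_def opp_def using ent_pos[of "m - 2" "Suc k"] m_ge by simp
qed

section \<open>Generators of the constructed scheme and their effect on frames\<close>

lemma ent_mod: "ent (k mod N) = ent k"
  using ent_add_N[of "k mod N" "k div N"] by simp

lemma lab_add_N: "lab (k + N) = lab k"
  by (simp add: lab_def N_def)

lemma lab_mod: "lab (k mod N) = lab k"
  by (simp add: lab_def N_def dvd_mod_iff)

lemma opp_mod: "opp (k mod N) = opp k"
  by (metis opp_def ent_mod mod_add_left_eq)

lemma quid_mod: "quid (k mod N) = quid k"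
  by (metis quid_def opp_mod ent_mod mod_Suc_eq)

lemma lab_Suc_mod: "lab (Suc (k mod N)) = lab (Suc k)"
  by (metis lab_mod mod_Suc_eq)

lemma frame_mod: "frame (k mod N) = frame k"
  by (simp add: frame_def fun_eq_iff lab_mod lab_Suc_mod opp_mod ent_mod)

lemma Suc_mod_pred: "(Suc k mod N + N - 1) mod N = k mod N"
proof -
  have "Suc k mod N + N - 1 = Suc k mod N + (N - 1)" using N_pos by simp
  then have "(Suc k mod N + N - 1) mod N = (Suc k + (N - 1)) mod N" by (simp add: mod_add_left_eq)
  also have "\<dots> = k mod N" using N_pos by simp
  finally show ?thesis .
qed

lemma scheme_objs: "objs scheme = {..<N}"
  by (simp add: scheme_def)

lemma rho_forward: "rho scheme (lab k) (k mod N) = Suc k mod N"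
  by (simp add: scheme_def lab_mod mod_Suc_eq)

lemma rho_backward: "rho scheme (lab k) (Suc k mod N) = k mod N"
  using Suc_mod_pred[of k] by (simp add: scheme_def lab_mod)

lemma cmat_scheme_diag: "cmat scheme x $ i $ i = 2"
  by (simp add: scheme_def)

lemma cmat_forward: "cmat scheme (k mod N) $ lab k $ lab (Suc k) = - quid k"
  by (simp add: scheme_def lab_mod quid_mod)

lemma cmat_backward: "cmat scheme (Suc k mod N) $ lab k = cmat scheme (k mod N) $ lab k"
proof -
  have "quid (Suc k mod N + N - 1) = quid k" using Suc_mod_pred quid_mod by metis
  then show ?thesis by (simp add: scheme_def lab_mod quid_mod vec_eq_iff)
qed

text \<open>Every generator runs along an edge of the cycle, forwards or backwards; claims about
  generators are checked in these two cases.\<close>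

lemma edge_cases:
  assumes "x \<in> objs scheme"
  obtains k where "x = k mod N" "i = lab k" | k where "x = Suc k mod N" "i = lab k"
proof (cases "i = lab x")
  case True
  then show ?thesis using that(1)[of x] assms by (simp add: scheme_objs)
next
  case False
  have "Suc (x + N - 1) = x + N" using N_pos by simp
  then have "x = Suc (x + N - 1) mod N" using assms by (simp add: scheme_objs)
  moreover have "lab (Suc (x + N - 1)) = lab x" using \<open>Suc (x + N - 1) = x + N\<close> lab_add_N by metis
  then have "i = lab (x + N - 1)" using False lab_cases[of i "x + N - 1"] by metis
  ultimately show ?thesis using that(2) by blast
qed

text \<open>The recursions \<open>ent_Suc\<close> and \<open>opp_Suc\<close> say exactly that this
  reflection is the change of basis from frame \<open>k\<close> to frame
  \<open>Suc k\<close>.\<close>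

lemma frame_refl_forward: "frame (Suc k) (refl_map scheme (lab k) (k mod N) v) = frame k v"
  by (simp add: frame_def opp_Suc ent_Suc refl_map_component[OF cmat_scheme_diag lab_simps(5)]
      cmat_forward) (simp add: vec_eq_iff algebra_simps)

lemma refl_backward:
  "refl_map scheme (lab k) (k mod N) (refl_map scheme (lab k) (Suc k mod N) v) = v"
  by (rule refl_map_involution) (simp_all add: cmat_scheme_diag cmat_backward)

lemma frame_refl:
  assumes "x \<in> objs scheme"
  shows "frame (rho scheme i x) (refl_map scheme i x v) = frame x v"
  using assms
proof (cases rule: edge_cases[where i = i])
  case (1 k)
  then show ?thesis by (simp add: rho_forward frame_mod frame_refl_forward)
next
  case (2 k)
  then show ?thesis
    using frame_refl_forward[of k "refl_map scheme (lab k) (Suc k mod N) v"]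
    by (simp add: rho_backward frame_mod refl_backward)
qed

lemma rho_scheme_closed: "rho scheme i x \<in> objs scheme"
  using N_pos by (simp add: scheme_def)

lemma cartan_scheme: "cartan_scheme scheme"
proof -
  note rho_scheme_closed
  moreover have "rho scheme i (rho scheme i x) = x" if "x \<in> objs scheme" for i x
    using that
    by (cases rule: edge_cases[where i = i]) (simp_all add: rho_forward rho_backward)
  moreover have "gen_cartan_matrix (cmat scheme x)" for x
    using quid_pos by (auto simp: gen_cartan_matrix_def scheme_def less_imp_le
      less_imp_neq[OF quid_pos, symmetric])
  moreover have "cmat scheme x $ i $ j = cmat scheme (rho scheme i x) $ i $ j" if "x \<in> objs scheme" for i j x
    using that
    by (cases rule: edge_cases[where i = i]) (simp_all add: rho_forward rho_backward cmat_backward)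
  moreover have "objs scheme \<noteq> {}" using N_pos by (auto simp: scheme_objs)
  ultimately show ?thesis unfolding cartan_scheme_def by blast
qed

lemma frame_coord:
  "v $ lab k = cross (frame k v) (opp k)" "v $ lab (Suc k) = cross (ent k) (frame k v)"
  using opp_unimodular[of k] by (simp_all add: frame_def)

lemma frame_inj:
  assumes "frame k v = frame k w"
  shows "v = w"
  unfolding vec_eq_iff all_lab[of _ k]
  using frame_coord[of v k] frame_coord[of w k] assms by simp

lemma frame_surj: "\<exists>v. frame k v = z"
proof
  let ?v = "cross z (opp k) *s simple_root (lab k) + cross (ent k) z *s simple_root (lab (Suc k))"
  show "frame k ?v = z"
    using unimodular_expansion[OF opp_unimodular, of z k] by (simp add: frame_def)
qed

lemma frame_simple_root: "\<exists>l. frame k (simple_root i) = ent l"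
proof (cases "i = lab k")
  case True
  then have "frame k (simple_root i) = ent k" by (simp add: frame_def vec_eq_iff)
  then show ?thesis ..
next
  case False
  then have "i = lab (Suc k)" using lab_cases by blast
  then have "frame k (simple_root i) = ent (k + (m - 1))" by (simp add: frame_def vec_eq_iff opp_def)
  then show ?thesis ..
qed

text \<open>Generators respect the frames, so a morphism is determined by its source and target.
  With \<open>frame_inj\<close> this leaves only the identity as an endomorphism.\<close>

lemma frame_Hom:
  assumes "\<phi> \<in> Hom scheme x y"
  shows "y \<in> objs scheme \<and> frame y (\<phi> v) = frame x v"
proof -
  have "(y, \<phi>) \<in> weyl_paths scheme x" using assms by (simp add: Hom_def)
  then show ?thesis
  proof (induction arbitrary: v)
    case (comp y \<phi> i)
    then show ?case by (simp add: frame_refl rho_scheme_closed)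
  qed simp
qed

lemma simply_connected: "simply_connected_scheme scheme"
proof -
  have "Hom scheme x x = {id}" if "x \<in> objs scheme" for x
  proof -
    have "id \<in> Hom scheme x x" using weyl_paths.id[OF that] unfolding Hom_def by blast
    moreover have "\<phi> = id" if "\<phi> \<in> Hom scheme x x" for \<phi>
    proof
      show "\<phi> v = id v" for v using frame_Hom[OF that, of v] frame_inj[of x "\<phi> v" v] by simp
    qed
    ultimately show ?thesis by blast
  qed
  then show ?thesis by (simp add: simply_connected_scheme_def)
qed

lemma connected: "connected_scheme scheme"
proof -
  have step: "\<exists>\<phi>. (((x + n) mod N), \<phi>) \<in> weyl_paths scheme x" if "x \<in> objs scheme" for x n
  proof (induction n)
    case 0
    have "(x + 0) mod N = x" using that by (simp add: scheme_objs)
    then show ?case using weyl_paths.id[OF that] by metis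
  next
    case (Suc n)
    then obtain \<phi> where "((x + n) mod N, \<phi>) \<in> weyl_paths scheme x" ..
    from weyl_paths.comp[OF this, of "lab (x + n)"] show ?case
      unfolding rho_forward by auto
  qed
  have "Hom scheme x y \<noteq> {}" if x: "x \<in> objs scheme" and y: "y \<in> objs scheme" for x y
  proof -
    have "x + (N - x + y) = y + N" using x by (simp add: scheme_objs)
    then have "(x + (N - x + y)) mod N = y" using y by (simp add: scheme_objs)
    then show ?thesis using step[OF x, of "N - x + y"] by (auto simp: Hom_def)
  qed
  then show ?thesis by (simp add: connected_scheme_def)
qed

text \<open>By \<open>frame_Hom\<close> roots have the same frame image as simple roots, namely an
  entry. Conversely \<open>ent l\<close> is the image of \<open>simple_root (lab l)\<close> at
  object \<open>l mod N\<close>, and connectedness supplies a morphism to \<open>x\<close>.\<close>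

lemma real_roots_scheme:
  assumes "x \<in> objs scheme"
  shows "real_roots scheme x = {v. frame x v \<in> range ent}"
proof
  show "real_roots scheme x \<subseteq> {v. frame x v \<in> range ent}"
  proof
    fix v assume "v \<in> real_roots scheme x"
    then obtain \<phi> i b where "v = \<phi> (simple_root i)" "\<phi> \<in> Hom scheme b x"
      unfolding real_roots_def by blast
    then have "frame x v = frame b (simple_root i)" using frame_Hom by simp
    then show "v \<in> {v. frame x v \<in> range ent}"
      using frame_simple_root[of b i] by auto
  qed
  show "{v. frame x v \<in> range ent} \<subseteq> real_roots scheme x"
  proof
    fix v assume "v \<in> {v. frame x v \<in> range ent}"
    then obtain l where l: "frame x v = ent (l mod N)" by (auto simp: ent_mod)
    have b: "l mod N \<in> objs scheme" using N_pos by (simp add: scheme_objs)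
    then obtain \<phi> where \<phi>: "\<phi> \<in> Hom scheme (l mod N) x"
      using connected assms unfolding connected_scheme_def by blast
    have "frame x (\<phi> (simple_root (lab (l mod N)))) = frame (l mod N) (simple_root (lab (l mod N)))"
      using frame_Hom[OF \<phi>] by simp
    also have "\<dots> = frame x v" unfolding l by (simp add: frame_def vec_eq_iff)
    finally have "v = \<phi> (simple_root (lab (l mod N)))" using frame_inj by metis
    then show "v \<in> real_roots scheme x" using b \<phi> unfolding real_roots_def by blast
  qed
qed

section \<open>Positive roots of the constructed scheme\<close>

lemma frame_minus: "frame k (- v) = - frame k v"
  by (simp add: frame_def vec_eq_iff)

lemma ent_shift: "\<exists>j<m. ent l = ent (x + j) \<or> ent l = - ent (x + j)"
proof -
  \<comment> \<open>Adding \<open>x\<close> periods raises the index \<open>l\<close> to at least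
    \<open>x\<close>, so that it can be written as \<open>x + d\<close>.\<close>
  have "x * 1 \<le> x * N" using N_pos by (intro mult_le_mono2) simp
  then have "x \<le> l + x * N" by linarith
  then obtain d where "l + x * N = x + d" using le_Suc_ex by blast
  then have "ent l = ent (x + d)" using ent_add_N[of l x] by metis
  also have "x + d = x + d mod m + d div m * m" by simp
  finally have "ent l = ent (x + d mod m + d div m * m)" by simp
  then have "ent l = ent (x + d mod m) \<or> ent l = - ent (x + d mod m)"
    unfolding ent_add by (simp split: if_splits)
  moreover have "d mod m < m" using m_ge by simp
  ultimately show ?thesis by blast
qed

text \<open>The coordinates of \<open>v\<close> are determinants against \<open>ent x\<close> and
  \<open>opp x\<close>, which is \<open>ent (x + (m - 1))\<close>: the two ends of a window of
  \<open>m\<close> entries spanning less than a half turn.\<close>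

lemma frame_nonneg:
  assumes "frame x v = ent (x + j)" "j < m"
  shows "v \<in> nonneg_vecs"
proof -
  have "0 \<le> cross (ent (x + j)) (opp x)"
  proof (cases "j = m - 1")
    case False
    then have "x + (m - 1) = x + j + (m - 1 - j)" using assms(2) by simp
    then show ?thesis
      using ent_pos[of "m - 1 - j" "x + j"] False assms(2) by (simp add: opp_def less_imp_le)
  qed (simp add: opp_def)
  moreover have "0 \<le> cross (ent x) (ent (x + j))"
    using ent_pos[of j x] assms(2) by (cases "j = 0") (simp_all add: less_imp_le)
  ultimately show ?thesis
    unfolding nonneg_vecs_def using frame_coord[of v x] assms(1) all_lab[of "\<lambda>i. 0 \<le> v $ i" x] by simp
qed

lemma ent_nonzero: "ent k \<noteq> 0"
  using ent_unimodular[of k] by (auto simp: cross_def)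

lemma positive_roots_scheme:
  assumes "x \<in> objs scheme"
  shows "real_roots scheme x \<inter> nonneg_vecs = frame x -` ((\<lambda>j. ent (x + j)) ` {..<m})"
proof
  show "frame x -` ((\<lambda>j. ent (x + j)) ` {..<m}) \<subseteq> real_roots scheme x \<inter> nonneg_vecs"
    using frame_nonneg by (auto simp: real_roots_scheme[OF assms])
  show "real_roots scheme x \<inter> nonneg_vecs \<subseteq> frame x -` ((\<lambda>j. ent (x + j)) ` {..<m})"
  proof
    fix v assume v: "v \<in> real_roots scheme x \<inter> nonneg_vecs"
    then obtain l where l: "frame x v = ent l" by (auto simp: real_roots_scheme[OF assms])
    obtain j where j: "j < m" "ent l = ent (x + j) \<or> ent l = - ent (x + j)"
      using ent_shift by blast
    have "ent l \<noteq> - ent (x + j)"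
    proof
      assume "ent l = - ent (x + j)"
      then have "frame x (- v) = ent (x + j)" using l by (simp add: frame_minus)
      then have "- v \<in> nonneg_vecs" using frame_nonneg j(1) by blast
      then have "v = 0" using v nonneg_vecs_antisym by blast
      then have "ent l = 0" using l by (simp add: frame_def vec_eq_iff)
      then show False using ent_nonzero by blast
    qed
    then show "v \<in> frame x -` ((\<lambda>j. ent (x + j)) ` {..<m})"
      using l j by auto
  qed
qed

lemma card_positive_roots_scheme:
  assumes "x \<in> objs scheme"
  shows "card (real_roots scheme x \<inter> nonneg_vecs) = m"
proof -
  have "inj_on (\<lambda>j. ent (x + j)) {..<m}"
  proof (rule linorder_inj_onI)
    fix i j assume ij: "i < j" "j \<in> {..<m}"
    then have "0 < cross (ent (x + i)) (ent (x + i + (j - i)))" by (intro ent_pos) auto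
    moreover have "x + i + (j - i) = x + j" using ij by simp
    ultimately show "ent (x + i) \<noteq> ent (x + j)" by auto
  qed auto
  moreover have "inj (frame x)" using frame_inj by (rule injI)
  moreover have "surj (frame x)" using frame_surj by (metis surjI)
  ultimately show ?thesis
    unfolding positive_roots_scheme[OF assms] by (simp add: card_vimage_inj card_image)
qed

lemma rotation_forward:
  "((rho scheme (lab (Suc k)) \<circ> rho scheme (lab k)) ^^ n) (k mod N) = (k + 2 * n) mod N"
proof (induction n)
  case (Suc n)
  have "lab (Suc k) = lab (Suc (k + 2 * n))" "lab k = lab (k + 2 * n)" by (simp_all add: lab_def)
  then show ?case using Suc rho_forward[of "k + 2 * n"] rho_forward[of "Suc (k + 2 * n)"] by simp
qed simp

lemma rotation_backward:
  "((rho scheme (lab k) \<circ> rho scheme (lab (Suc k))) ^^ n) ((k + 2 * n) mod N) = k mod N"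
proof (induction n)
  case (Suc n)
  have "lab (Suc k) = lab (Suc (k + 2 * n))" "lab k = lab (k + 2 * n)" by (simp_all add: lab_def)
  then have "(rho scheme (lab k) \<circ> rho scheme (lab (Suc k))) ((k + 2 * Suc n) mod N) = (k + 2 * n) mod N"
    using rho_backward[of "k + 2 * n"] rho_backward[of "Suc (k + 2 * n)"] by simp
  then show ?case unfolding funpow_Suc_right comp_def using Suc by (simp add: comp_def)
qed simp

text \<open>Each composite moves two places, forwards or backwards according to which index labels
  \<open>x\<close>, so \<open>m\<close> of them go once around the \<open>2 * m\<close>
  objects.\<close>

lemma rotation:
  assumes "x \<in> objs scheme" "i \<noteq> j"
  shows "((rho scheme i \<circ> rho scheme j) ^^ m) x = x"
proof -
  have x: "x mod N = x" "(x + 2 * m) mod N = x" using assms(1) by (simp_all add: scheme_objs N_def)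
  show ?thesis
  proof (cases "i = lab x")
    case True
    then have "j = lab (Suc x)" using assms(2) lab_cases[of j x] by blast
    then show ?thesis using rotation_backward[where k = x and n = m] True x by simp
  next
    case False
    then have "i = lab (Suc x)" "j = lab x"
      using assms(2) lab_cases[of i x] lab_cases[of j x] by auto
    then show ?thesis using rotation_forward[where k = x and n = m] x by simp
  qed
qed

lemma uminus_root:
  assumes "x \<in> objs scheme" "v \<in> real_roots scheme x"
  shows "- v \<in> real_roots scheme x"
proof -
  obtain l where "frame x v = ent l" using assms by (auto simp: real_roots_scheme)
  then have "frame x (- v) = ent (l + m)" by (simp add: frame_minus ent_add_m)
  then show ?thesis using assms(1) by (simp add: real_roots_scheme)
qed

lemma root_sign_scheme:
  assumes "x \<in> objs scheme" "v \<in> real_roots scheme x"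
  shows "v \<in> nonneg_vecs \<or> - v \<in> nonneg_vecs"
proof -
  obtain l where l: "frame x v = ent l" using assms by (auto simp: real_roots_scheme)
  obtain j where j: "j < m" "ent l = ent (x + j) \<or> ent l = - ent (x + j)"
    using ent_shift by blast
  then have "frame x v = ent (x + j) \<or> frame x (- v) = ent (x + j)"
    using l by (auto simp: frame_minus)
  then show ?thesis using frame_nonneg j(1) by blast
qed

lemma root_multiple_scheme:
  assumes "x \<in> objs scheme" "c *s simple_root i \<in> real_roots scheme x"
  shows "c = 1 \<or> c = -1"
proof -
  obtain z where z: "frame x (simple_root i) = ent z" using frame_simple_root by blast
  obtain l where l: "frame x (c *s simple_root i) = ent l" using assms by (auto simp: real_roots_scheme)
  have "frame x (c *s simple_root i) = c *s frame x (simple_root i)"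
    by (simp add: frame_def vec_eq_iff algebra_simps)
  then have "ent l = c *s ent z" using z l by simp
  \<comment> \<open>Entries are primitive: determinant 1 with the successor makes \<open>c\<close> a
    unit.\<close>
  then have "c * cross (ent z) (ent (Suc l)) = 1" using ent_unimodular[of l] by simp
  then show ?thesis by (auto simp: zmult_eq_1_iff)
qed

lemma simple_root_in_scheme: "x \<in> objs scheme \<Longrightarrow> simple_root i \<in> real_roots scheme x"
  using frame_simple_root[of x i] by (auto simp: real_roots_scheme)

lemma refl_image_scheme:
  assumes "x \<in> objs scheme"
  shows "refl_map scheme i x ` real_roots scheme x = real_roots scheme (rho scheme i x)"
proof -
  have iff: "refl_map scheme i x v \<in> real_roots scheme (rho scheme i x) \<longleftrightarrow> v \<in> real_roots scheme x" for v
    by (simp add: real_roots_scheme assms rho_scheme_closed frame_refl)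
  have inv: "refl_map scheme i x (refl_map scheme i x v) = v" for v
    by (rule refl_map_involution) (simp_all add: cmat_scheme_diag)
  show ?thesis
  proof
    show "real_roots scheme (rho scheme i x) \<subseteq> refl_map scheme i x ` real_roots scheme x"
    proof
      fix v assume "v \<in> real_roots scheme (rho scheme i x)"
      then have "refl_map scheme i x v \<in> real_roots scheme x"
        using iff[of "refl_map scheme i x v"] inv by simp
      then show "v \<in> refl_map scheme i x ` real_roots scheme x" using inv by (metis imageI)
    qed
  qed (use iff in blast)
qed

lemma finite_root_system_scheme: "finite_root_system scheme (real_roots scheme)"
proof -
  have sign: "real_roots scheme x = (real_roots scheme x \<inter> nonneg_vecs) \<union> uminus ` (real_roots scheme x \<inter> nonneg_vecs)"
    (is "?R = ?P \<union> uminus ` ?P") if x: "x \<in> objs scheme" for x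
  proof
    show "?R \<subseteq> ?P \<union> uminus ` ?P"
    proof
      fix v assume v: "v \<in> ?R"
      show "v \<in> ?P \<union> uminus ` ?P"
      proof (cases "v \<in> nonneg_vecs")
        case False
        then have "- v \<in> ?P" using root_sign_scheme[OF x v] uminus_root[OF x v] by blast
        then have "- (- v) \<in> uminus ` ?P" by (rule imageI)
        then show ?thesis by simp
      qed (use v in blast)
    qed
  qed (use uminus_root[OF x] in blast)
  have simple: "real_roots scheme x \<inter> range (\<lambda>k. k *s simple_root i) = {simple_root i, - simple_root i}"
    if x: "x \<in> objs scheme" for x i
  proof
    have unit: "1 *s simple_root i = simple_root i" "(-1) *s simple_root i = - simple_root i"
      by (simp_all add: vec_eq_iff)
    then show "real_roots scheme x \<inter> range (\<lambda>k. k *s simple_root i) \<subseteq> {simple_root i, - simple_root i}"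
      using root_multiple_scheme[OF x, of _ i] by blast
    have "simple_root i \<in> range (\<lambda>k. k *s simple_root i)" "- simple_root i \<in> range (\<lambda>k. k *s simple_root i)"
      using unit by (metis rangeI)+
    then show "{simple_root i, - simple_root i} \<subseteq> real_roots scheme x \<inter> range (\<lambda>k. k *s simple_root i)"
      using simple_root_in_scheme[OF x] uminus_root[OF x] by blast
  qed
  have rot: "let S = real_roots scheme x \<inter> {int p *s simple_root i + int q *s simple_root j | p q. True}
      in finite S \<longrightarrow> ((rho scheme i \<circ> rho scheme j) ^^ card S) x = x"
    if "x \<in> objs scheme" "i \<noteq> j" for x i j
    unfolding nonneg_combinations[OF that(2)] Let_def card_positive_roots_scheme[OF that(1)]
    using rotation[OF that] by blast
  have fin: "finite (real_roots scheme x)" if x: "x \<in> objs scheme" for x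
  proof -
    have "finite (real_roots scheme x \<inter> nonneg_vecs)"
      using card_positive_roots_scheme[OF x] m_ge by (intro card_ge_0_finite) simp
    then show ?thesis using sign[OF x] by (metis finite_Un finite_imageI)
  qed
  then show ?thesis
    unfolding finite_root_system_def root_system_def
    by (intro conjI ballI allI impI)
      (rule sign simple refl_image_scheme rot fin; assumption)+
qed

lemma realizes_scheme: "realizes scheme f"
proof -
  have zero: "0 \<in> objs scheme" using N_pos by (simp add: scheme_objs)
  \<comment> \<open>\<open>ent 0\<close> and \<open>opp 0\<close> are (0,1) and (1,0), matching the
    labels 2 and 1, so the roots at object 0 are the entries themselves.\<close>
  have "frame 0 v = v" for v
    by (simp add: frame_def opp_def ent_ends[unfolded One_nat_def] vec_eq_iff forall_2)
  then have "real_roots scheme 0 \<inter> nonneg_vecs = ent ` {..<m}"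
    unfolding positive_roots_scheme[OF zero] by auto
  also have "\<dots> = set f" by (auto simp: ent_small m_def set_conv_nth)
  finally show ?thesis
    unfolding realizes_def
    using cartan_scheme connected simply_connected finite_root_system_scheme zero by blast
qed

end

theorem proposition3p7:
  shows "(\<forall>f. F_seq f \<longrightarrow>
            (\<exists>C :: nat cartan_data. realizes C f) \<and>
            (\<forall>(C :: 'a cartan_data) (D :: 'b cartan_data).
               realizes C f \<longrightarrow> realizes D f \<longrightarrow> equivalent_schemes C D)) \<and>
         (\<forall>(C :: 'c cartan_data) a.
            cartan_scheme C \<longrightarrow> irreducible_scheme C \<longrightarrow>
            finite_root_system C (real_roots C) \<longrightarrow> a \<in> objs C \<longrightarrow>
            (\<exists>vs. sorts_to (real_roots C a \<inter> nonneg_vecs) vs) \<and>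
            (\<forall>vs. sorts_to (real_roots C a \<inter> nonneg_vecs) vs \<longrightarrow> F_seq vs))"
proof (intro conjI allI impI)
  fix f assume "F_seq f"
  then interpret f_sequence f by unfold_locales
  show "\<exists>C :: nat cartan_data. realizes C f" using realizes_scheme by blast
next
  fix f and C :: "'a cartan_data" and D :: "'b cartan_data"
  assume "realizes C f" "realizes D f"
  then show "equivalent_schemes C D" by (rule realizes_equivalent)
next
  fix C :: "'c cartan_data" and a
  assume "cartan_scheme C" "irreducible_scheme C" "finite_root_system C (real_roots C)" "a \<in> objs C"
  then interpret based_root_system C "real_roots C" a by unfold_locales
  have indec: "indecomposable (cmat C a)"
    using \<open>irreducible_scheme C\<close> base by (simp add: irreducible_scheme_def)
  show "\<exists>vs. sorts_to (real_roots C a \<inter> nonneg_vecs) vs" using sorts_to_root_seq by blast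
  show "F_seq vs" if "sorts_to (real_roots C a \<inter> nonneg_vecs) vs" for vs
    using sorts_to_unique[OF that] F_seq_root_seq[OF indec] by simp
qed

end
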